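(* Let $m\ge1$ and $l$ be integers with $l-m-1\ge 1$, let $\{P_0,\dots,P_m\}$ be a symmetric Clifford system on $\mathbb{R}^{2l}$, and let $$G_F(x)=|x|^4-\sum_{\alpha=0}^m\langle P_\alpha x,x\rangle^2,\qquad x\in\mathbb{R}^{2l}.$$ Write $(m_+,m_-)=(m,l-m-1)$. Then $G_F$ is a sum of squares of real polynomials if and only if one of the following holds: $(m_+,m_-)=(1,k)$ for some $k\in\mathbb{N}^+$; $(m_+,m_-)=(2,2k-1)$ for some $k\in\mathbb{N}^+$; $(m_+,m_-)=(3,4)$; $(m_+,m_-)=(4,3)$ and the Clifford system is of indefinite class (denoted $(4,3)^I$); $(m_+,m_-)=(5,2)$; or $(m_+,m_-)=(6,1)$.
   Context: A symmetric Clifford system on $\mathbb{R}^{2l}$ is a family $\{P_0,\dots,P_m\}$ of real symmetric $2l\times 2l$ matrices with $P_\alpha P_\beta+P_\beta P_\alpha=2\delta_{\alpha\beta}I_{2l}$. The associated OT-FKM type isoparametric polynomial is $F(x)=|x|^4-2\sum_{\alpha=0}^m\langle P_\alpha x,x\rangle^2$, with multiplicity pair $(m_+,m_-)=(m,l-m-1)$, both entries positive, and $G_F=(|x|^4+F)/2$. For $(m_+,m_-)=(4,3)$ (so $m=4$, $l=8$), the Clifford system is of definite class if $P_0P_1P_2P_3P_4=\pm I_{16}$, and of indefinite class otherwise. *)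

theory Defs
  imports "HOL-Analysis.Analysis"
begin

text \<open>
  A family is a function on \<open>nat\<close> of which only the members with index
  \<open>0, \<dots>, m\<close> matter.
\<close>

definition symmetric_clifford_system :: "nat \<Rightarrow> (nat \<Rightarrow> real^'n^'n) \<Rightarrow> bool" where
  "symmetric_clifford_system m P \<longleftrightarrow>
     (\<forall>\<alpha>\<le>m. transpose (P \<alpha>) = P \<alpha>) \<and>
     (\<forall>\<alpha>\<le>m. \<forall>\<beta>\<le>m.
        P \<alpha> ** P \<beta> + P \<beta> ** P \<alpha> = (2 * (if \<alpha> = \<beta> then 1 else 0)) *\<^sub>R mat 1)"

definition G_F :: "nat \<Rightarrow> (nat \<Rightarrow> real^'n^'n) \<Rightarrow> real^'n \<Rightarrow> real" where
  "G_F m P x = norm x ^ 4 - (\<Sum>\<alpha>=0..m. ((P \<alpha> *v x) \<bullet> x)\<^sup>2)"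

text \<open>
  Real polynomials in the coordinates of \<open>x\<close> are identified with the polynomial
  functions they induce, which is harmless over the infinite field of real numbers.
\<close>

definition sum_of_squares_of_polynomials :: "(real^'n \<Rightarrow> real) \<Rightarrow> bool" where
  "sum_of_squares_of_polynomials f \<longleftrightarrow>
     (\<exists>(N::nat) p. (\<forall>i<N. real_polynomial_function (p i)) \<and>
                   (\<forall>x. f x = (\<Sum>i<N. (p i x)\<^sup>2)))"

definition multiplicity_pair :: "nat \<Rightarrow> nat \<Rightarrow> nat \<times> nat" where
  "multiplicity_pair m l = (m, l - m - 1)"

text \<open>
  The classes are only meaningful for Clifford systems with multiplicity pair \<open>(4, 3)\<close>,
  i.e.\ for \<open>m = 4\<close> and matrices of size 16.
\<close>

definition definite_class :: "(nat \<Rightarrow> real^'n^'n) \<Rightarrow> bool" where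
  "definite_class P \<longleftrightarrow>
     P 0 ** P 1 ** P 2 ** P 3 ** P 4 = mat 1 \<or> P 0 ** P 1 ** P 2 ** P 3 ** P 4 = - mat 1"

definition indefinite_class :: "(nat \<Rightarrow> real^'n^'n) \<Rightarrow> bool" where
  "indefinite_class P \<longleftrightarrow> \<not> definite_class P"

end

theory Submission
  imports Defs
begin

text \<open>
  Let \<open>\<omega> = P\<^sub>0 P\<^sub>1 P\<^sub>2 P\<^sub>3\<close> when \<open>m \<ge> 3\<close>; this is a symmetric involution that anticommutes with its four
  factors.

  Necessity rests on the zeros of \<open>G\<^sub>F\<close>.  If \<open>G\<^sub>F\<close> is a sum of squares, each summand \<open>p\<close> is a quadratic
  form, since \<open>p\<^sup>2 \<le> |x|\<^sup>4\<close>, and vanishes on the eigenspaces of every \<open>P\<^sub>\<alpha>\<close>, where \<open>G\<^sub>F\<close> vanishes.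
  Hence \<open>p\<close> changes sign under every \<open>P\<^sub>\<alpha>\<close> (\<open>summand_P\<close>), and for \<open>m \<ge> 3\<close> it is invariant under
  \<open>\<omega>\<close>.  The fixed space of \<open>\<omega>\<close> has dimension \<open>l\<close> and is a quaternionic vector space, so
  \<open>l\<close> is a multiple of four.  For unit vectors \<open>x\<close>, \<open>y\<close> on orthogonal quaternionic lines, the
  invariance gives \<open>p (x + P\<^sub>0 y) = p x - p y\<close>, while for \<open>m = 3\<close> the values of \<open>G\<^sub>F\<close> at \<open>x\<close>, \<open>y\<close>
  and \<open>x + P\<^sub>0 y\<close> are \<open>1\<close>, \<open>1\<close> and \<open>4\<close>.  By the parallelogram law for numbers the squares of
  \<open>p x + p y\<close> sum to \<open>0\<close>, so \<open>p y = - p x\<close> for all summands.  This is impossible for three mutually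
  orthogonal lines; larger \<open>m\<close> reduce to \<open>m = 3\<close>.  Hence
  \<open>l \<le> 8\<close> (\<open>dim_fixed_space_le_8_if_sum_of_squares\<close>), and \<open>l \<ge> 5\<close> leaves only \<open>l = 8\<close>.  In the definite
  class \<open>P\<^sub>4\<close> is \<open>\<omega>\<close> up to sign, so \<open>p\<close> is both invariant and changes sign, whence \<open>p = 0\<close>
  (\<open>not_sum_of_squares_definite\<close>).  For \<open>m = 2\<close> the only restriction is that \<open>l\<close> is even, because
  \<open>P\<^sub>0 P\<^sub>1\<close> and \<open>P\<^sub>0 P\<^sub>2\<close> make the whole space quaternionic, of dimension \<open>2 l\<close>.

  Sufficiency is by explicit identities.  For \<open>m = 1\<close> and \<open>m = 2\<close> the form \<open>G\<^sub>F\<close> is the defect in the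
  real, respectively complex, Cauchy-Schwarz inequality for the two halves of \<open>x\<close>, and Lagrange's
  identity applies.  For \<open>m \<ge> 3\<close> and \<open>l = 8\<close>, project the rank-one matrix \<open>x x\<^sup>T\<close> to the space of
  symmetric matrices that anticommute with \<open>P\<^sub>0, \<dots>, P\<^sub>3\<close>.  The squared length of the projection is
  a sixteenth of \<open>|x|\<^sup>4 - \<langle>P\<^sub>0 x, x\<rangle>\<^sup>2 - \<dots> - \<langle>P\<^sub>3 x, x\<rangle>\<^sup>2 + \<langle>\<omega> x, x\<rangle>\<^sup>2\<close>.  The matrices
  \<open>\<omega>, P\<^sub>4, \<dots>, P\<^sub>m\<close> belong to this space, have squared length \<open>2 l = 16\<close>, and are mutually orthogonal
  outside the definite class.  Removing the components along them leaves a matrix of squared length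
  \<open>G\<^sub>F / 16\<close> whose entries are quadratic polynomials (\<open>sum_of_squares_if_orthogonal\<close>).
\<close>

section \<open>Polynomials of quadratic growth\<close>

lemma real_polynomial_quadratic_growth:
  fixes f :: "real \<Rightarrow> real"
  assumes f: "real_polynomial_function f" and bound: "\<And>t. 1 \<le> \<bar>t\<bar> \<Longrightarrow> \<bar>f t\<bar> \<le> C * t\<^sup>2"
  obtains a b c where "\<And>t. f t = a + b * t + c * t\<^sup>2"
proof -
  obtain d n where d: "f = (\<lambda>t. \<Sum>i\<le>n. d i * t ^ i)"
    using f unfolding real_polynomial_function_iff_sum by blast
  define a where "a i = (if i \<le> n then d i else 0)" for i
  define g where "g t = (\<Sum>i\<le>n. a (i + 2) * t ^ i)" for t :: real
  have f_eq: "f t = a 0 + a 1 * t + t\<^sup>2 * g t" for t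
  proof -
    have "f t = (\<Sum>i\<le>n. a i * t ^ i)"
      by (simp add: d a_def)
    also have "\<dots> = (\<Sum>i\<le>Suc (Suc n). a i * t ^ i)"
      by (simp add: a_def)
    also have "\<dots> = a 0 + (a 1 * t + (\<Sum>i\<le>n. a (Suc (Suc i)) * t ^ Suc (Suc i)))"
      by (simp only: sum.atMost_Suc_shift) simp
    also have "(\<Sum>i\<le>n. a (Suc (Suc i)) * t ^ Suc (Suc i)) = t\<^sup>2 * g t"
      by (simp add: g_def sum_distrib_left power2_eq_square algebra_simps)
    finally show ?thesis by simp
  qed
  have "\<not> (\<exists>k. k \<noteq> 0 \<and> k \<le> n \<and> a (k + 2) \<noteq> 0)"
  proof
    \<comment> \<open>If \<open>g\<close> is not constant, then \<open>\<bar>g\<bar>\<close> exceeds \<open>B\<close> far out, and \<open>t\<^sup>2 \<bar>g t\<bar>\<close>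
      exceeds what \<open>f\<close> and the two lowest terms can supply.\<close>
    define B where "B = C + \<bar>a 0\<bar> + \<bar>a 1\<bar> + 1"
    assume "\<exists>k. k \<noteq> 0 \<and> k \<le> n \<and> a (k + 2) \<noteq> 0"
    then have "eventually (\<lambda>t. norm (\<Sum>i\<le>n. a (i + 2) * t ^ i) \<ge> B) at_infinity"
      by (rule Poly_Roots.polyfun_extremal)
    then obtain r where r: "\<And>t. r \<le> norm t \<Longrightarrow> B \<le> \<bar>g t\<bar>"
      unfolding eventually_at_infinity g_def by auto
    define t where "t = max r 1"
    have t: "1 \<le> t" "B \<le> \<bar>g t\<bar>"
      by (auto simp: t_def intro!: r)
    have tt: "1 \<le> t\<^sup>2" "t \<le> t\<^sup>2"
      using t(1) by (auto simp: power2_eq_square mult_ge1_I)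
    have "t\<^sup>2 * g t = f t - a 0 - a 1 * t"
      by (simp add: f_eq)
    then have "\<bar>t\<^sup>2 * g t\<bar> \<le> \<bar>f t\<bar> + \<bar>a 0\<bar> + \<bar>a 1 * t\<bar>"
      by linarith
    then have "t\<^sup>2 * \<bar>g t\<bar> \<le> \<bar>f t\<bar> + \<bar>a 0\<bar> + \<bar>a 1\<bar> * t"
      using t(1) by (simp add: abs_mult)
    also have "\<dots> \<le> C * t\<^sup>2 + \<bar>a 0\<bar> * t\<^sup>2 + \<bar>a 1\<bar> * t\<^sup>2"
      using bound[of t] t tt by (intro add_mono mult_left_mono) (auto simp: mult_le_cancel_left1)
    also have "\<dots> = t\<^sup>2 * (B - 1)"
      by (simp add: B_def algebra_simps)
    also have "\<dots> < t\<^sup>2 * \<bar>g t\<bar>"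
      using t tt by (intro mult_strict_left_mono) auto
    finally show False by simp
  qed
  then have "g t = a 2" for t
  proof -
    assume *: "\<not> (\<exists>k. k \<noteq> 0 \<and> k \<le> n \<and> a (k + 2) \<noteq> 0)"
    have "g t = (\<Sum>i\<le>n. if i = 0 then a 2 else 0)"
      unfolding g_def using * by (intro sum.cong refl) (auto simp: numeral_2_eq_2)
    then show ?thesis by simp
  qed
  with f_eq show thesis
    by (intro that[of "a 0" "a 1" "a 2"]) (simp add: mult.commute)
qed

text \<open>
  A polynomial bounded by a multiple of \<open>|x|\<^sup>2\<close> is a quadratic form, and the parallelogram law is
  all of this that is used below.  Working along lines avoids multivariate degrees: every restriction
  to a line has degree at most two, and homogeneity identifies its leading coefficient.
\<close>

lemma real_polynomial_parallelogram:
  fixes p :: "'a::real_normed_vector \<Rightarrow> real"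
  assumes p: "real_polynomial_function p" and bound: "\<And>x. \<bar>p x\<bar> \<le> C * (norm x)\<^sup>2"
  shows "p (x + y) + p (x - y) = 2 * p x + 2 * p y"
proof -
  have line: "\<exists>a b c. \<forall>t. p (u + t *\<^sub>R v) = a + b * t + c * t\<^sup>2" for u v
  proof -
    have "polynomial_function (\<lambda>t::real. u + t *\<^sub>R v)"
      by (intro polynomial_function_add polynomial_function_const
          polynomial_function_bounded_linear bounded_linear_scaleR_left)
    from real_polynomial_function_compose[OF this p]
    have poly: "real_polynomial_function (\<lambda>t. p (u + t *\<^sub>R v))"
      by (simp add: o_def)
    have growth: "\<bar>p (u + t *\<^sub>R v)\<bar> \<le> (\<bar>C\<bar> * (norm u + norm v)\<^sup>2) * t\<^sup>2" if "1 \<le> \<bar>t\<bar>" for t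
    proof -
      have "norm (u + t *\<^sub>R v) \<le> norm u + \<bar>t\<bar> * norm v"
        by (metis norm_scaleR norm_triangle_ineq)
      also have "\<dots> \<le> \<bar>t\<bar> * norm u + \<bar>t\<bar> * norm v"
        using that by (simp add: mult_le_cancel_right1)
      finally have "(norm (u + t *\<^sub>R v))\<^sup>2 \<le> (\<bar>t\<bar> * (norm u + norm v))\<^sup>2"
        by (intro power_mono) (auto simp: algebra_simps)
      then have "\<bar>C\<bar> * (norm (u + t *\<^sub>R v))\<^sup>2 \<le> \<bar>C\<bar> * (\<bar>t\<bar> * (norm u + norm v))\<^sup>2"
        by (intro mult_left_mono) auto
      moreover have "C * (norm (u + t *\<^sub>R v))\<^sup>2 \<le> \<bar>C\<bar> * (norm (u + t *\<^sub>R v))\<^sup>2"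
        by (intro mult_right_mono) auto
      ultimately show ?thesis
        using bound[of "u + t *\<^sub>R v"] by (simp add: power_mult_distrib mult_ac)
    qed
    show ?thesis
      by (rule real_polynomial_quadratic_growth[OF poly growth]) blast+
  qed
  have hom: "p (t *\<^sub>R z) = t\<^sup>2 * p z" for t z
  proof -
    obtain a b c where abc: "\<And>t. p (t *\<^sub>R z) = a + b * t + c * t\<^sup>2"
      using line[of 0 z] by auto
    have "p 0 = 0" using bound[of 0] by simp
    with abc[of 0] have a: "a = 0" by simp
    define K where "K = \<bar>C\<bar> * (norm z)\<^sup>2 + \<bar>c\<bar>"
    have b_le: "\<bar>b\<bar> \<le> K * s" if "s > 0" for s
    proof -
      have "C * (norm z)\<^sup>2 \<le> \<bar>C\<bar> * (norm z)\<^sup>2"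
        by (intro mult_right_mono) auto
      then have "C * (norm z)\<^sup>2 * s\<^sup>2 \<le> \<bar>C\<bar> * (norm z)\<^sup>2 * s\<^sup>2"
        by (intro mult_right_mono) auto
      then have "\<bar>b * s + c * s\<^sup>2\<bar> \<le> \<bar>C\<bar> * (norm z)\<^sup>2 * s\<^sup>2"
        using bound[of "s *\<^sub>R z"] abc[of s] a by (simp add: power_mult_distrib mult_ac)
      moreover have "\<bar>b * s\<bar> \<le> \<bar>b * s + c * s\<^sup>2\<bar> + \<bar>c\<bar> * s\<^sup>2"
        using abs_triangle_ineq4[of "b * s + c * s\<^sup>2" "c * s\<^sup>2"] by (simp add: abs_mult)
      ultimately have "\<bar>b\<bar> * s \<le> (K * s) * s"
        using that by (simp add: abs_mult K_def algebra_simps power2_eq_square)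
      then show ?thesis using that by simp
    qed
    have "b = 0"
    proof (rule ccontr)
      assume "b \<noteq> 0"
      have K: "K \<ge> 0" by (simp add: K_def)
      have "\<bar>b\<bar> \<le> K * (\<bar>b\<bar> / (K + 1))"
        using \<open>b \<noteq> 0\<close> K by (intro b_le) auto
      also have "\<dots> < \<bar>b\<bar>"
        using \<open>b \<noteq> 0\<close> K by (simp add: field_simps)
      finally show False by simp
    qed
    then show ?thesis using abc[of t] abc[of 1] a by simp
  qed
  obtain a b c where xy: "\<And>t. p (x + t *\<^sub>R y) = a + b * t + c * t\<^sup>2"
    using line by blast
  obtain a' b' c' where yx: "\<And>s. p (y + s *\<^sub>R x) = a' + b' * s + c' * s\<^sup>2"
    using line by blast
  \<comment> \<open>Homogeneity turns the restriction to the line through \<open>x\<close> into the one through \<open>y\<close>,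
    with the coefficients in the opposite order.\<close>
  have swap: "a' + b' * s + c' * s\<^sup>2 = a * s\<^sup>2 + b * s + c" if "s \<noteq> 0" for s
  proof -
    have "y + s *\<^sub>R x = s *\<^sub>R (x + (1 / s) *\<^sub>R y)"
      using that by (simp add: algebra_simps)
    then have "p (y + s *\<^sub>R x) = s\<^sup>2 * (a + b * (1 / s) + c * (1 / s)\<^sup>2)"
      by (simp only: hom xy)
    also have "\<dots> = a * s\<^sup>2 + b * s + c"
      using that by (simp add: field_simps power2_eq_square)
    finally show ?thesis by (simp add: yx)
  qed
  have "c = p y"
    using swap[of 1] swap[of "-1"] swap[of 2] yx[of 0] by simp
  moreover have "a = p x"
    using xy[of 0] by simp
  ultimately show ?thesis
    using xy[of 1] xy[of "-1"] by simp
qed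

section \<open>Sums of squares of polynomials\<close>

lemma sum_of_squares_sum:
  assumes "finite I" and "\<And>i. i \<in> I \<Longrightarrow> real_polynomial_function (p i)"
  shows "sum_of_squares_of_polynomials (\<lambda>x. \<Sum>i\<in>I. (p i x)\<^sup>2)"
proof -
  obtain h where h: "bij_betw h {0..<card I} I"
    using ex_bij_betw_nat_finite[OF assms(1)] by blast
  have "(\<Sum>i\<in>I. (p i x)\<^sup>2) = (\<Sum>i<card I. (p (h i) x)\<^sup>2)" for x
    using sum.reindex_bij_betw[OF h, of "\<lambda>i. (p i x)\<^sup>2"] by (simp add: atLeast0LessThan)
  moreover have "real_polynomial_function (p (h i))" if "i < card I" for i
    using that h by (intro assms(2)) (auto simp: bij_betw_def)
  ultimately show ?thesis
    unfolding sum_of_squares_of_polynomials_def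
    by (intro exI[of _ "card I"] exI[of _ "\<lambda>i. p (h i)"]) auto
qed

lemma sum_of_squares_add:
  assumes "sum_of_squares_of_polynomials f" "sum_of_squares_of_polynomials g"
  shows "sum_of_squares_of_polynomials (\<lambda>x. f x + g x)"
proof -
  obtain M :: nat and p where p: "\<forall>i<M. real_polynomial_function (p i)" "\<forall>x. f x = (\<Sum>i<M. (p i x)\<^sup>2)"
    using assms(1) unfolding sum_of_squares_of_polynomials_def by blast
  obtain N :: nat and q where q: "\<forall>i<N. real_polynomial_function (q i)" "\<forall>x. g x = (\<Sum>i<N. (q i x)\<^sup>2)"
    using assms(2) unfolding sum_of_squares_of_polynomials_def by blast
  have "sum_of_squares_of_polynomials
          (\<lambda>x. \<Sum>i\<in>{..<M} <+> {..<N}. ((case i of Inl j \<Rightarrow> p j | Inr j \<Rightarrow> q j) x)\<^sup>2)"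
    by (rule sum_of_squares_sum) (use p q in auto)
  then show ?thesis
    by (simp add: sum.Plus p q)
qed

lemma real_polynomial_matrix_entry:
  fixes A :: "real^'n^'n"
  shows "real_polynomial_function (\<lambda>x. (A *v x) $ i)"
proof -
  have "bounded_linear (\<lambda>x. (A *v x) $ i)"
    by (intro bounded_linear_compose[OF bounded_linear_vec_nth] matrix_vector_mul_bounded_linear)
  then show ?thesis by (rule real_polynomial_function.intros)
qed

lemma real_polynomial_matrix_form:
  fixes A :: "real^'n^'n"
  shows "real_polynomial_function (\<lambda>x. (A *v x) \<bullet> x)"
  unfolding inner_vec_def inner_real_def
  using real_polynomial_matrix_entry[of A] real_polynomial_matrix_entry[of "mat 1"]
  by (intro real_polynomial_function_sum real_polynomial_function.intros(4)) auto

lemma sum_of_squares_matrix: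
  fixes Q :: "real^'n \<Rightarrow> real^'n^'n"
  assumes "\<And>i j. real_polynomial_function (\<lambda>x. Q x $ i $ j)" "0 \<le> c"
  shows "sum_of_squares_of_polynomials (\<lambda>x. c * (Q x \<bullet> Q x))"
proof -
  have "sum_of_squares_of_polynomials
      (\<lambda>x. \<Sum>ij\<in>UNIV. (sqrt c * Q x $ fst ij $ snd ij)\<^sup>2)"
    using assms(1)
    by (intro sum_of_squares_sum real_polynomial_function.intros(4)[OF real_polynomial_function.intros(2)]) auto
  also have "(\<lambda>x. \<Sum>ij\<in>UNIV. (sqrt c * Q x $ fst ij $ snd ij)\<^sup>2) =
      (\<lambda>x. \<Sum>ij\<in>UNIV. c * (Q x $ fst ij $ snd ij)\<^sup>2)"
    using assms(2) by (simp add: power_mult_distrib)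
  also have "\<dots> = (\<lambda>x. c * (Q x \<bullet> Q x))"
    by (simp add: inner_vec_def sum.cartesian_product sum_distrib_left
        power2_eq_square case_prod_beta flip: UNIV_Times_UNIV)
  finally show ?thesis .
qed

section \<open>Dimensions and orthonormal bases\<close>

lemma matrix_vector_mult_neg [simp]: "(A :: real^'n^'m) *v (- x) = - (A *v x)"
  by (rule linear_neg[OF matrix_vector_mul_linear])

text \<open>
  The space \<open>V\<close> is a module over the quaternions: a quaternionic line, spanned by
  \<open>x\<close>, \<open>J x\<close>, \<open>K x\<close>, \<open>J K x\<close>, has real dimension four, and its orthogonal complement
  is again invariant because \<open>J\<close> and \<open>K\<close> are skew.
\<close>

lemma four_dvd_dim_quaternionic:
  fixes J K :: "'a::euclidean_space \<Rightarrow> 'a"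
  assumes lin: "linear J" "linear K"
    and skew: "\<And>x y. J x \<bullet> y = - (x \<bullet> J y)" "\<And>x y. K x \<bullet> y = - (x \<bullet> K y)"
    and sq: "\<And>x. J (J x) = - x" "\<And>x. K (K x) = - x"
    and anti: "\<And>x. K (J x) = - J (K x)"
    and "subspace V" "J ` V \<subseteq> V" "K ` V \<subseteq> V"
  shows "4 dvd dim V"
  using \<open>subspace V\<close> \<open>J ` V \<subseteq> V\<close> \<open>K ` V \<subseteq> V\<close>
proof (induction "dim V" arbitrary: V rule: less_induct)
  case less
  show ?case
  proof (cases "dim V = 0")
    case False
    then obtain x where x: "x \<in> V" "x \<noteq> 0"
      by (metis dim_eq_0 subsetI singletonI)
    have neg: "J (- y) = - J y" "K (- y) = - K y" for y
      using lin by (auto simp: linear_neg)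
    have self: "J y \<bullet> y = 0" "K y \<bullet> y = 0" for y
      using skew(1)[of y y] skew(2)[of y y] by (auto simp: inner_commute)
    have self': "y \<bullet> J y = 0" "y \<bullet> K y = 0" for y
      using self[of y] by (auto simp: inner_commute)
    have JK: "J (K y) \<bullet> y = 0" "y \<bullet> J (K y) = 0" for y
    proof -
      have "J (K y) \<bullet> y = y \<bullet> K (J y)"
        by (simp add: skew)
      then show "J (K y) \<bullet> y = 0"
        by (simp add: anti inner_commute)
      then show "y \<bullet> J (K y) = 0"
        by (simp add: inner_commute)
    qed
    define B where "B = {x, J x, K x, J (K x)}"
    have inners: "x \<bullet> J x = 0" "x \<bullet> K x = 0" "x \<bullet> J (K x) = 0" "J x \<bullet> K x = 0"
        "J x \<bullet> J (K x) = 0" "K x \<bullet> J (K x) = 0"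
      using self self' JK by (simp_all add: skew sq)
    have nonzero: "J x \<noteq> 0" "K x \<noteq> 0" "J (K x) \<noteq> 0"
      using x(2) sq lin by (metis linear_0 neg_equal_0_iff_equal)+
    have orth: "pairwise orthogonal B"
      using inners by (auto simp: B_def pairwise_def orthogonal_def inner_commute)
    have ne: "0 \<notin> B"
      using x nonzero by (auto simp: B_def)
    have distinct: "x \<noteq> J x" "x \<noteq> K x" "x \<noteq> J (K x)" "J x \<noteq> K x" "J x \<noteq> J (K x)" "K x \<noteq> J (K x)"
      using inners nonzero x(2) by (metis inner_eq_zero_iff)+
    have card: "card B = 4"
      using distinct by (auto simp: B_def)
    define W where "W = span B"
    have dimW: "dim W = 4"
      unfolding W_def dim_span
      using dim_eq_card_independent[OF pairwise_orthogonal_independent[OF orth ne]] card by simp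
    have BV: "B \<subseteq> V"
      using x less.prems by (auto simp: B_def)
    then have WV: "W \<subseteq> V"
      unfolding W_def using less.prems(1) by (simp add: span_minimal)
    have JB: "J ` B \<subseteq> W" and KB: "K ` B \<subseteq> W"
      unfolding W_def B_def
      by (auto simp: sq anti neg intro!: span_neg intro: span_base)
    have JW: "J ` W \<subseteq> W" and KW: "K ` W \<subseteq> W"
      using span_minimal[OF JB] span_minimal[OF KB] lin
      by (simp_all add: W_def linear_span_image)
    define V' where "V' = {y \<in> V. \<forall>w\<in>W. orthogonal w y}"
    have dims: "dim V' + 4 = dim V"
      using dim_subspace_orthogonal_to_vectors[of W V] WV less.prems(1) dimW
      by (simp add: V'_def W_def)
    have "4 dvd dim V'"
    proof (rule less.hyps)
      show "dim V' < dim V" using dims by simp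
      show "subspace V'"
        using less.prems(1)
        by (auto simp: V'_def subspace_def orthogonal_def inner_simps)
      have "w \<bullet> J y = 0" "w \<bullet> K y = 0" if "w \<in> W" "y \<in> V'" for w y
      proof -
        have "J w \<in> W" "K w \<in> W" using JW KW that by auto
        then have "J w \<bullet> y = 0" "K w \<bullet> y = 0"
          using that by (auto simp: V'_def orthogonal_def)
        then show "w \<bullet> J y = 0" "w \<bullet> K y = 0"
          by (auto simp: skew)
      qed
      then show "J ` V' \<subseteq> V'" "K ` V' \<subseteq> V'"
        using less.prems by (auto simp: V'_def orthogonal_def)
    qed
    then show ?thesis
      using dims by (metis dvd_add_triv_right_iff)
  next
    case True
    then show ?thesis by (simp only: dvd_0_right)
  qed
qed

text \<open>
  The involution \<open>B\<close> exchanges the two eigenspaces of \<open>A\<close>, so each is half of the space.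
\<close>

lemma dim_fixed_space_swapped:
  fixes A B :: "'a::euclidean_space \<Rightarrow> 'a"
  assumes lin: "linear A" "linear B"
    and inv: "\<And>x. A (A x) = x" "\<And>x. B (B x) = x"
    and anti: "\<And>x. A (B x) = - B (A x)"
    and V: "subspace V" "A ` V \<subseteq> V" "B ` V \<subseteq> V"
  shows "dim V = 2 * dim {x \<in> V. A x = x}"
proof -
  let ?E = "{x \<in> V. A x = x}" and ?F = "{x \<in> V. A x = - x}"
  have sub: "subspace ?E" "subspace ?F"
    using V(1) lin(1)
    by (auto simp: subspace_def linear_0 linear_add linear_cmul)
  have "{x + y |x y. x \<in> ?E \<and> y \<in> ?F} = V"
  proof (intro equalityI subsetI)
    fix v assume v: "v \<in> V"
    let ?x = "(1/2) *\<^sub>R (v + A v)" and ?y = "(1/2) *\<^sub>R (v - A v)"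
    have "?x \<in> ?E" "?y \<in> ?F"
      using v V lin inv
      by (auto simp: linear_add linear_diff linear_cmul algebra_simps image_subset_iff
          intro!: subspace_add subspace_diff subspace_scale)
    moreover have "v = ?x + ?y"
      by (simp add: scaleR_2[symmetric] flip: scaleR_add_right)
    ultimately show "v \<in> {x + y |x y. x \<in> ?E \<and> y \<in> ?F}" by blast
  qed (use V(1) in \<open>auto intro: subspace_add\<close>)
  then have "dim V + dim (?E \<inter> ?F) = dim ?E + dim ?F"
    using dim_sums_Int[OF sub] by simp
  moreover have "?E \<inter> ?F \<subseteq> {0}"
  proof
    fix x assume "x \<in> ?E \<inter> ?F"
    then have "x = - x" by auto
    then have "2 *\<^sub>R x = 0"
      unfolding scaleR_2 by (metis add.right_inverse)
    then show "x \<in> {0}" by simp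
  qed
  then have "dim (?E \<inter> ?F) = 0"
    by (simp only: dim_eq_0)
  ultimately have "dim V = dim ?E + dim ?F"
    by linarith
  moreover have "dim ?E \<le> dim ?F"
  proof -
    have "inj_on B ?E" using inv(2) by (metis inj_onI)
    then have "inj_on B (span ?E)"
      using sub(1) span_eq_iff by metis
    then have "dim ?E = dim (B ` ?E)"
      by (rule dim_image_eq[OF lin(2), symmetric])
    also have "\<dots> \<le> dim ?F"
      using V anti by (intro dim_subset) auto
    finally show ?thesis .
  qed
  moreover have "dim ?F \<le> dim ?E"
  proof -
    have "inj_on B ?F" using inv(2) by (metis inj_onI)
    then have "inj_on B (span ?F)"
      using sub(2) span_eq_iff by metis
    then have "dim ?F = dim (B ` ?F)"
      by (rule dim_image_eq[OF lin(2), symmetric])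
    also have "\<dots> \<le> dim ?E"
      using V anti lin(2) by (intro dim_subset) (auto simp: linear_neg)
    finally show ?thesis .
  qed
  ultimately show ?thesis by simp
qed

lemma exists_unit_vector_orthogonal:
  fixes V :: "'a::euclidean_space set"
  assumes V: "subspace V" and S: "finite S" "card S < dim V"
  obtains u where "u \<in> V" "norm u = 1" "\<And>s. s \<in> S \<Longrightarrow> s \<bullet> u = 0"
proof -
  define T where "T = {y. \<forall>x\<in>span S. orthogonal x y}"
  have T: "subspace T"
    unfolding T_def using subspace_orthogonal_to_vectors[of "span S"]
    by (simp add: orthogonal_commute)
  have "dim T + dim (span S) = DIM('a)"
    using dim_subspace_orthogonal_to_vectors[of "span S" UNIV] by (simp add: T_def)
  moreover have "dim (span S) \<le> card S"
    using S(1) by (simp add: dim_le_card')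
  moreover have "dim {x + y |x y. x \<in> V \<and> y \<in> T} + dim (V \<inter> T) = dim V + dim T"
    by (rule dim_sums_Int[OF V T])
  moreover have "dim {x + y |x y. x \<in> V \<and> y \<in> T} \<le> DIM('a)"
    by (rule dim_subset_UNIV)
  ultimately have "dim (V \<inter> T) \<noteq> 0"
    using S(2) by linarith
  then obtain y where y: "y \<in> V" "y \<in> T" "y \<noteq> 0"
    by (metis IntE dim_eq_0 singletonI subsetI)
  show thesis
  proof
    show "y /\<^sub>R norm y \<in> V"
      using V y(1) by (simp add: subspace_scale)
    show "norm (y /\<^sub>R norm y) = 1"
      using y(3) by simp
    show "s \<bullet> (y /\<^sub>R norm y) = 0" if "s \<in> S" for s
      using that y(2) by (auto simp: T_def orthogonal_def intro: span_base)
  qed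
qed

text \<open>
  The Frobenius inner product, that is the trace of \<open>A\<^sup>T C\<close>, can be evaluated on any
  orthonormal basis.  A basis adapted to eigenspaces turns dimensions into traces.
\<close>

lemma inner_matrix_orthonormal_basis:
  fixes A C :: "real^'n^'n"
  assumes B: "pairwise orthogonal B" "\<And>b. b \<in> B \<Longrightarrow> norm b = 1" "span B = UNIV"
  shows "A \<bullet> C = (\<Sum>b\<in>B. (A *v b) \<bullet> (C *v b))"
proof -
  have fin: "finite B" using B(1) by (rule pairwise_orthogonal_imp_finite)
  have parseval: "u \<bullet> v = (\<Sum>b\<in>B. (u \<bullet> b) * (v \<bullet> b))" for u v :: "real^'n"
  proof -
    have "u \<bullet> v = (\<Sum>b\<in>B. (u \<bullet> b) *\<^sub>R b) \<bullet> v"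
      using orthonormal_basis_expand[OF B(1,2), of u] fin B(3) by simp
    also have "\<dots> = (\<Sum>b\<in>B. (u \<bullet> b) * (b \<bullet> v))"
      by (simp add: inner_sum_left)
    finally show ?thesis
      by (simp only: inner_commute[of _ v])
  qed
  have "(\<Sum>b\<in>B. (A *v b) \<bullet> (C *v b)) = (\<Sum>b\<in>B. \<Sum>i\<in>UNIV. (A $ i \<bullet> b) * (C $ i \<bullet> b))"
    by (simp add: inner_vec_def[of "_ *v _"] matrix_vector_mul_component)
  also have "\<dots> = (\<Sum>i\<in>UNIV. A $ i \<bullet> C $ i)"
    by (subst sum.swap) (simp flip: parseval)
  finally show ?thesis by (simp add: inner_vec_def[of A])
qed

section \<open>Clifford systems\<close>

locale clifford_system =
  fixes m :: nat and P :: "nat \<Rightarrow> real^'n^'n"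
  assumes clifford: "symmetric_clifford_system m P"
begin

lemma P_sym: "\<alpha> \<le> m \<Longrightarrow> transpose (P \<alpha>) = P \<alpha>"
  using clifford by (simp add: symmetric_clifford_system_def)

lemma P_inner: "\<alpha> \<le> m \<Longrightarrow> (P \<alpha> *v x) \<bullet> y = x \<bullet> (P \<alpha> *v y)"
  by (metis P_sym dot_lmul_matrix vector_transpose_matrix)

lemma P_involution [simp]: "\<alpha> \<le> m \<Longrightarrow> P \<alpha> *v (P \<alpha> *v x) = x"
proof -
  assume "\<alpha> \<le> m"
  then have "P \<alpha> ** P \<alpha> + P \<alpha> ** P \<alpha> = 2 *\<^sub>R mat 1"
    using clifford by (simp add: symmetric_clifford_system_def)
  then have "P \<alpha> ** P \<alpha> = mat 1"
    unfolding scaleR_2[symmetric] by simp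
  then show ?thesis
    by (simp add: matrix_vector_mul_assoc)
qed

lemma P_anticommute:
  assumes "\<alpha> \<le> m" "\<beta> \<le> m" "\<alpha> \<noteq> \<beta>"
  shows "P \<alpha> *v (P \<beta> *v x) = - (P \<beta> *v (P \<alpha> *v x))"
proof -
  have "P \<alpha> ** P \<beta> + P \<beta> ** P \<alpha> = 0"
    using clifford assms by (simp add: symmetric_clifford_system_def)
  then have "P \<alpha> ** P \<beta> *v x + P \<beta> ** P \<alpha> *v x = 0"
    by (metis matrix_vector_mult_0 matrix_vector_mult_add_rdistrib)
  then show ?thesis
    by (simp add: matrix_vector_mul_assoc eq_neg_iff_add_eq_0)
qed

lemma P_inner_P: "\<alpha> \<le> m \<Longrightarrow> (P \<alpha> *v x) \<bullet> (P \<alpha> *v y) = x \<bullet> y"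
  by (simp add: P_inner)

lemma inner_PP_self:
  assumes "\<alpha> \<le> m" "\<beta> \<le> m" "\<alpha> \<noteq> \<beta>"
  shows "x \<bullet> (P \<alpha> *v (P \<beta> *v x)) = 0"
proof -
  have "x \<bullet> (P \<alpha> *v (P \<beta> *v x)) = (P \<beta> *v (P \<alpha> *v x)) \<bullet> x"
    using assms by (simp add: P_inner)
  also have "\<dots> = - (x \<bullet> (P \<alpha> *v (P \<beta> *v x)))"
    using P_anticommute[OF assms, of x] by (simp add: inner_commute)
  finally show ?thesis by simp
qed

text \<open>
  The products \<open>P\<^sub>0 P\<^sub>1\<close> and \<open>P\<^sub>0 P\<^sub>2\<close> are anticommuting complex structures.
\<close>

lemma four_dvd_dim_invariant:
  assumes m: "2 \<le> m" and V: "subspace V"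
    and inv: "\<And>\<alpha> x. \<alpha> \<in> {1, 2} \<Longrightarrow> x \<in> V \<Longrightarrow> P 0 *v (P \<alpha> *v x) \<in> V"
  shows "4 dvd dim V"
proof (rule four_dvd_dim_quaternionic[OF _ _ _ _ _ _ _ V])
  let ?J = "\<lambda>x. P 0 *v (P 1 *v x)" and ?K = "\<lambda>x. P 0 *v (P 2 *v x)"
  have sort: "P 1 *v (P 0 *v x) = - (P 0 *v (P 1 *v x))" "P 2 *v (P 0 *v x) = - (P 0 *v (P 2 *v x))"
    "P 2 *v (P 1 *v x) = - (P 1 *v (P 2 *v x))" for x
    by (rule P_anticommute; use m in simp)+
  show "linear ?J" "linear ?K"
    by (auto intro!: linearI simp: matrix_vector_right_distrib matrix_vector_mult_scaleR)
  show "?J x \<bullet> y = - (x \<bullet> ?J y)" "?K x \<bullet> y = - (x \<bullet> ?K y)" for x y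
    using m by (simp_all add: P_inner sort sort[simplified])
  show "?J (?J x) = - x" "?K (?K x) = - x" "?K (?J x) = - ?J (?K x)" for x
    using m by (simp_all add: sort sort[simplified])
  show "?J ` V \<subseteq> V" "?K ` V \<subseteq> V"
    using inv[of 1] inv[of 2] by auto
qed

lemma four_dvd_CARD: "2 \<le> m \<Longrightarrow> 4 dvd CARD('n)"
  using four_dvd_dim_invariant[OF _ subspace_UNIV] by simp

text \<open>
  A summand \<open>p\<close> is a quadratic form because \<open>p\<^sup>2 \<le> G\<^sub>F \<le> |x|\<^sup>4\<close>, and it vanishes on the
  zeros of \<open>G\<^sub>F\<close>, among them the eigenvectors \<open>x + P\<^sub>\<alpha> x\<close> and \<open>x - P\<^sub>\<alpha> x\<close> of \<open>P\<^sub>\<alpha>\<close>.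
  By the parallelogram law \<open>p\<close> therefore changes sign under \<open>P\<^sub>\<alpha>\<close>.
\<close>

lemma summand_of_G_F:
  assumes poly: "\<forall>i<N. real_polynomial_function (p i)"
    and G: "\<forall>x. G_F m P x = (\<Sum>i<N. (p i x)\<^sup>2)" and i: "i < (N::nat)"
  shows summand_parallelogram: "p i (x + y) + p i (x - y) = 2 * p i x + 2 * p i y"
    and summand_P: "\<alpha> \<le> m \<Longrightarrow> p i (P \<alpha> *v x) = - p i x"
proof -
  have le: "(p i y)\<^sup>2 \<le> G_F m P y" for y
    unfolding spec[OF G] using i by (intro member_le_sum) auto
  have "\<bar>p i y\<bar> \<le> 1 * (norm y)\<^sup>2" for y
  proof -
    have "(\<Sum>\<alpha>=0..m. ((P \<alpha> *v y) \<bullet> y)\<^sup>2) \<ge> 0"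
      by (intro sum_nonneg) auto
    then have "(p i y)\<^sup>2 \<le> norm y ^ 4"
      using le[of y] by (simp add: G_F_def)
    then have "(p i y)\<^sup>2 \<le> ((norm y)\<^sup>2)\<^sup>2"
      by (simp flip: power_mult)
    then show ?thesis
      using abs_le_square_iff[of "p i y" "(norm y)\<^sup>2"] by simp
  qed
  note par = real_polynomial_parallelogram[OF poly[rule_format, OF i] this]
  show "p i (x + y) + p i (x - y) = 2 * p i x + 2 * p i y"
    by (rule par)
  assume \<alpha>: "\<alpha> \<le> m"
  have zero: "p i y = 0" if "P \<alpha> *v y = y \<or> P \<alpha> *v y = - y" for y
  proof -
    have "((P \<alpha> *v y) \<bullet> y)\<^sup>2 \<le> (\<Sum>\<beta>=0..m. ((P \<beta> *v y) \<bullet> y)\<^sup>2)"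
      using \<alpha> by (intro member_le_sum) auto
    moreover have "((P \<alpha> *v y) \<bullet> y)\<^sup>2 = norm y ^ 4"
      using that by (auto simp: dot_square_norm simp flip: power_mult)
    ultimately have "G_F m P y \<le> 0"
      by (simp add: G_F_def)
    then show ?thesis
      using le[of y] by (smt (verit) zero_le_power2 power2_eq_iff zero_power2)
  qed
  have "p i (x + P \<alpha> *v x) = 0" "p i (x - P \<alpha> *v x) = 0"
    using \<alpha> by (auto intro!: zero simp: matrix_vector_right_distrib matrix_vector_mult_diff_distrib)
  then show "p i (P \<alpha> *v x) = - p i x"
    using par[of x "P \<alpha> *v x"] by simp
qed

end

section \<open>The volume element\<close>

locale clifford_system_ge3 = clifford_system m P
  for m :: nat and P :: "nat \<Rightarrow> real^'n^'n" +
  assumes three_le: "3 \<le> m"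
begin

text \<open>
  A form that changes sign under every \<open>P\<^sub>\<alpha>\<close> is invariant under any product of an even number of
  them.  This product of four is the shortest one that is a symmetric involution, so it splits the
  space into two eigenspaces.
\<close>

definition volume :: "real^'n^'n" where
  "volume = P 0 ** P 1 ** P 2 ** P 3"

lemma volume_apply: "volume *v x = P 0 *v (P 1 *v (P 2 *v (P 3 *v x)))"
  by (simp add: volume_def matrix_vector_mul_assoc matrix_mul_assoc)

text \<open>
  Oriented rewrite rules that put products of the first four members into increasing order.
\<close>

lemma P_sort:
  "P 1 *v (P 0 *v x) = - (P 0 *v (P 1 *v x))" "P 2 *v (P 0 *v x) = - (P 0 *v (P 2 *v x))"
  "P 3 *v (P 0 *v x) = - (P 0 *v (P 3 *v x))" "P 2 *v (P 1 *v x) = - (P 1 *v (P 2 *v x))"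
  "P 3 *v (P 1 *v x) = - (P 1 *v (P 3 *v x))" "P 3 *v (P 2 *v x) = - (P 2 *v (P 3 *v x))"
  by (rule P_anticommute; use three_le in simp)+

lemma volume_inner: "(volume *v x) \<bullet> y = x \<bullet> (volume *v y)"
  using three_le by (simp add: volume_apply P_inner P_sort P_sort[simplified])

lemma volume_involution [simp]: "volume *v (volume *v x) = x"
  using three_le by (simp add: volume_apply P_sort P_sort[simplified])

lemma volume_P_anticommute:
  assumes "\<alpha> \<le> 3"
  shows "volume *v (P \<alpha> *v x) = - (P \<alpha> *v (volume *v x))"
proof -
  have "\<alpha> = 0 \<or> \<alpha> = 1 \<or> \<alpha> = 2 \<or> \<alpha> = 3"
    using assms by linarith
  then show ?thesis
    using three_le by (elim disjE) (simp_all add: volume_apply P_sort P_sort[simplified])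
qed

lemma volume_P_commute:
  assumes "3 < \<alpha>" "\<alpha> \<le> m"
  shows "volume *v (P \<alpha> *v x) = P \<alpha> *v (volume *v x)"
proof -
  have "P \<beta> *v (P \<alpha> *v y) = - (P \<alpha> *v (P \<beta> *v y))" if "\<beta> \<le> 3" for \<beta> y
    using assms that three_le by (intro P_anticommute) auto
  note this[of 0] this[of 1] this[of 2] this[of 3]
  from this this[simplified] show ?thesis
    by (simp add: volume_apply)
qed

lemma volume_inner_P:
  assumes "volume *v x = x" "volume *v y = y" "\<alpha> \<le> 3"
  shows "(P \<alpha> *v x) \<bullet> y = 0"
proof -
  have "(P \<alpha> *v x) \<bullet> y = (volume *v (P \<alpha> *v x)) \<bullet> y"
    by (simp add: volume_inner assms)
  also have "\<dots> = - ((P \<alpha> *v x) \<bullet> y)"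
    using assms by (simp add: volume_P_anticommute)
  finally show ?thesis by simp
qed

text \<open>
  The products \<open>P\<^sub>0 P\<^sub>\<alpha>\<close> with \<open>\<alpha> = 1, 2, 3\<close> commute with the volume element and make this space
  quaternionic, of half the ambient dimension.
\<close>

definition fixed_space :: "(real^'n) set" where
  "fixed_space = {x. volume *v x = x}"

lemma subspace_fixed_space: "subspace fixed_space"
  by (auto simp: fixed_space_def subspace_def matrix_vector_right_distrib matrix_vector_mult_scaleR)

lemma dim_invariant_eq:
  assumes "subspace V" "(*v) volume ` V \<subseteq> V" "(*v) (P 0) ` V \<subseteq> V"
  shows "dim V = 2 * dim {x \<in> V. volume *v x = x}"
  using assms
  by (intro dim_fixed_space_swapped[of _ "(*v) (P 0)"])
     (auto simp: volume_P_anticommute matrix_vector_mul_linear)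

lemma dim_fixed_space: "CARD('n) = 2 * dim fixed_space"
  using dim_invariant_eq[of UNIV] by (simp add: fixed_space_def)

lemma four_dvd_dim_fixed:
  assumes V: "subspace V" "\<And>\<alpha>. \<alpha> \<le> 3 \<Longrightarrow> (*v) (P \<alpha>) ` V \<subseteq> V"
  shows "4 dvd dim {x \<in> V. volume *v x = x}"
proof (rule four_dvd_dim_invariant)
  show "2 \<le> m"
    using three_le by simp
  show "subspace {x \<in> V. volume *v x = x}"
    using subspace_inter[OF V(1) subspace_fixed_space] by (simp add: fixed_space_def Int_def)
  show "P 0 *v (P \<alpha> *v x) \<in> {x \<in> V. volume *v x = x}"
    if "\<alpha> \<in> {1, 2}" "x \<in> {x \<in> V. volume *v x = x}" for \<alpha> x
  proof -
    have "P \<beta> *v y \<in> V" if "\<beta> \<le> 3" "y \<in> V" for \<beta> y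
      using V(2)[OF that(1)] that(2) by blast
    moreover have "\<alpha> \<le> 3"
      using that(1) by auto
    ultimately show ?thesis
      using that(2) by (simp add: volume_P_anticommute)
  qed
qed

lemma four_dvd_dim_fixed_space: "4 dvd dim fixed_space"
  using four_dvd_dim_fixed[of UNIV] by (simp add: fixed_space_def)

section \<open>Obstructions to sums of squares\<close>

text \<open>
  The condition on \<open>y\<close> says that it is orthogonal to the quaternionic line, of dimension four,
  through each \<open>x\<close> in \<open>S\<close>.
\<close>

lemma exists_in_fixed_space_orthogonal:
  assumes "finite S" "4 * card S < dim fixed_space"
  shows "\<exists>y\<in>fixed_space. norm y = 1 \<and> (\<forall>x\<in>S. \<forall>\<alpha>\<le>3. (P \<alpha> *v x) \<bullet> (P 0 *v y) = 0)"
proof -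
  let ?S = "(\<lambda>(x, \<alpha>). P 0 *v (P \<alpha> *v x)) ` (S \<times> {..3::nat})"
  have "card ?S \<le> card (S \<times> {..3::nat})"
    using assms(1) by (intro card_image_le) auto
  then have "card ?S < dim fixed_space"
    using assms by (simp add: card_cartesian_product)
  then obtain y where y: "y \<in> fixed_space" "norm y = 1" "\<And>s. s \<in> ?S \<Longrightarrow> s \<bullet> y = 0"
    using exists_unit_vector_orthogonal[OF subspace_fixed_space, of ?S] assms(1) by blast
  have "(P \<alpha> *v x) \<bullet> (P 0 *v y) = 0" if "x \<in> S" "\<alpha> \<le> 3" for x \<alpha>
    using y(3)[of "P 0 *v (P \<alpha> *v x)"] that by (force simp: P_inner)
  with y show ?thesis by blast
qed

text \<open>
  Under these hypotheses all four forms \<open>\<langle>P\<^sub>\<alpha> z, z\<rangle>\<close> vanish at \<open>z = x + P\<^sub>0 y\<close>: the diagonal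
  terms because \<open>P\<^sub>\<alpha>\<close> exchanges the eigenspaces of the volume element, the mixed terms by
  orthogonality of the quaternionic lines of \<open>x\<close> and \<open>y\<close>.
\<close>

lemma G_F_3_pair:
  assumes "x \<in> fixed_space" "y \<in> fixed_space" and orth: "\<And>\<alpha>. \<alpha> \<le> 3 \<Longrightarrow> (P \<alpha> *v x) \<bullet> (P 0 *v y) = 0"
  shows "G_F 3 P (x + P 0 *v y) = ((norm x)\<^sup>2 + (norm y)\<^sup>2)\<^sup>2"
proof -
  let ?z = "x + P 0 *v y"
  have fixed: "volume *v x = x" "volume *v y = y"
    using assms by (auto simp: fixed_space_def)
  have "(P \<alpha> *v ?z) \<bullet> ?z = 0" if \<alpha>: "\<alpha> \<le> 3" for \<alpha>
  proof -
    have "(P \<alpha> *v x) \<bullet> x = 0" "(P \<alpha> *v x) \<bullet> (P 0 *v y) = 0"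
      using \<alpha> orth fixed by (auto intro: volume_inner_P)
    moreover from this have "(P \<alpha> *v (P 0 *v y)) \<bullet> x = 0"
      using \<alpha> three_le P_inner[of \<alpha> "P 0 *v y" x] by (simp add: inner_commute)
    moreover have "(P \<alpha> *v (P 0 *v y)) \<bullet> (P 0 *v y) = 0"
    proof (cases "\<alpha> = 0")
      case True
      then show ?thesis
        using volume_inner_P[OF fixed(2,2), of 0] by (simp add: inner_commute)
    next
      case False
      then have "(P \<alpha> *v (P 0 *v y)) \<bullet> (P 0 *v y) = - ((P \<alpha> *v y) \<bullet> y)"
        using P_anticommute[of \<alpha> 0 y] \<alpha> three_le by (simp add: P_inner_P)
      then show ?thesis
        using volume_inner_P[OF fixed(2,2) \<alpha>] by simp
    qed
    ultimately show ?thesis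
      by (simp add: matrix_vector_right_distrib inner_add_left inner_add_right)
  qed
  then have "G_F 3 P ?z = norm ?z ^ 4"
    by (simp add: G_F_def)
  also have "\<dots> = (?z \<bullet> ?z)\<^sup>2"
    by (simp add: dot_square_norm flip: power_mult)
  also have "?z \<bullet> ?z = (norm x)\<^sup>2 + (norm y)\<^sup>2"
  proof -
    have "(P 0 *v y) \<bullet> x = 0" "x \<bullet> (P 0 *v y) = 0"
      using volume_inner_P[OF fixed(2,1), of 0] by (auto simp: inner_commute)
    then show ?thesis
      unfolding inner_add_left inner_add_right by (simp add: P_inner_P power2_norm_eq_inner)
  qed
  finally show ?thesis .
qed

lemma G_F_3_fixed_space: "x \<in> fixed_space \<Longrightarrow> G_F 3 P x = norm x ^ 4"
  using G_F_3_pair[of x 0] by (simp add: fixed_space_def flip: power_mult)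

lemma summand_volume:
  assumes poly: "\<forall>i<N. real_polynomial_function (p i)"
    and G: "\<forall>x. G_F m P x = (\<Sum>i<N. (p i x)\<^sup>2)" and i: "i < (N::nat)"
  shows "p i (volume *v x) = p i x"
  using three_le by (simp add: volume_apply summand_P[OF poly G i])

lemma G_F_eq_G_F_3: "G_F m P x = G_F 3 P x - (\<Sum>\<alpha>=4..m. ((P \<alpha> *v x) \<bullet> x)\<^sup>2)"
proof -
  have "{0..m} = {0..3} \<union> {4..m}"
    using three_le by auto
  then have "(\<Sum>\<alpha>=0..m. ((P \<alpha> *v x) \<bullet> x)\<^sup>2) =
      (\<Sum>\<alpha>=0..3. ((P \<alpha> *v x) \<bullet> x)\<^sup>2) + (\<Sum>\<alpha>=4..m. ((P \<alpha> *v x) \<bullet> x)\<^sup>2)"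
    by (simp add: sum.union_disjoint)
  then show ?thesis
    by (simp add: G_F_def)
qed

text \<open>
  Dropping members of the system adds squares, so the obstruction only has to be found for \<open>m = 3\<close>.
\<close>

lemma sum_of_squares_G_F_3:
  assumes "sum_of_squares_of_polynomials (G_F m P)"
  shows "sum_of_squares_of_polynomials (G_F 3 P)"
proof -
  have "sum_of_squares_of_polynomials
      (\<lambda>x. G_F m P x + (\<Sum>\<alpha>=4..m. ((P \<alpha> *v x) \<bullet> x)\<^sup>2))"
    by (intro sum_of_squares_add assms sum_of_squares_sum real_polynomial_matrix_form) auto
  then show ?thesis
    by (simp add: G_F_eq_G_F_3)
qed

text \<open>
  On the fixed space a summand is a quaternionic Hermitian form, and on two orthogonal quaternionic
  lines its diagonal entries are opposite.  Three mutually orthogonal lines would force all of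
  them to vanish, although their squares sum to \<open>G\<^sub>F = 1\<close> at unit vectors.
\<close>

lemma dim_fixed_space_le_8_if_sum_of_squares:
  assumes "sum_of_squares_of_polynomials (G_F m P)"
  shows "dim fixed_space \<le> 8"
proof (rule ccontr)
  assume "\<not> dim fixed_space \<le> 8"
  then have big: "8 < dim fixed_space" by simp
  interpret three: clifford_system_ge3 3 P
  proof
    show "symmetric_clifford_system 3 P"
      using clifford three_le unfolding symmetric_clifford_system_def by (meson le_trans)
  qed simp
  obtain N :: nat and p where p: "\<forall>i<N. real_polynomial_function (p i)"
      and G: "\<forall>x. G_F 3 P x = (\<Sum>i<N. (p i x)\<^sup>2)"
    using sum_of_squares_G_F_3[OF assms] unfolding sum_of_squares_of_polynomials_def by blast
  note par = three.summand_parallelogram[OF p G]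
    and P = three.summand_P[OF p G]
    and volume = three.summand_volume[OF p G]
  obtain x where x: "x \<in> fixed_space" "norm x = 1"
    using exists_in_fixed_space_orthogonal[of "{}"] big by auto
  obtain y where y: "y \<in> fixed_space" "norm y = 1"
      and xy: "\<And>\<alpha>. \<alpha> \<le> 3 \<Longrightarrow> (P \<alpha> *v x) \<bullet> (P 0 *v y) = 0"
    using exists_in_fixed_space_orthogonal[of "{x}"] big by auto
  have "4 * card {x, y} < dim fixed_space"
    using card_insert_le_m1[of 2 "{y}" x] big by simp
  then obtain z where z: "z \<in> fixed_space" "norm z = 1"
      and xz: "\<And>\<alpha>. \<alpha> \<le> 3 \<Longrightarrow> (P \<alpha> *v x) \<bullet> (P 0 *v z) = 0"
      and yz: "\<And>\<alpha>. \<alpha> \<le> 3 \<Longrightarrow> (P \<alpha> *v y) \<bullet> (P 0 *v z) = 0"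
    using exists_in_fixed_space_orthogonal[of "{x, y}"] by auto
  have unit: "(\<Sum>i<N. (p i u)\<^sup>2) = 1" if "u \<in> fixed_space" "norm u = 1" for u
    using G_F_3_fixed_space[of u] that by (simp add: G)
  have opposite: "p i v = - p i u"
    if u: "u \<in> fixed_space" "norm u = 1" and v: "v \<in> fixed_space" "norm v = 1"
      and uv: "\<And>\<alpha>. \<alpha> \<le> 3 \<Longrightarrow> (P \<alpha> *v u) \<bullet> (P 0 *v v) = 0" and i: "i < N" for u v i
  proof -
    have diff: "p j (u + P 0 *v v) = p j u - p j v" if j: "j < N" for j
    proof -
      \<comment> \<open>The two terms on the left of the parallelogram law agree, since the volume element
        maps one argument to the other.\<close>
      have "volume *v (u + P 0 *v v) = u - P 0 *v v"
        using u v by (simp add: fixed_space_def volume_P_anticommute matrix_vector_right_distrib)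
      then have "p j (u - P 0 *v v) = p j (u + P 0 *v v)"
        using volume[OF j, of "u + P 0 *v v"] by simp
      then show ?thesis
        using par[OF j, of u "P 0 *v v"] P[OF j, of 0 v] by simp
    qed
    have "(\<Sum>j<N. (p j u - p j v)\<^sup>2) = (\<Sum>j<N. (p j (u + P 0 *v v))\<^sup>2)"
      by (intro sum.cong) (auto simp: diff)
    also have "\<dots> = 4"
      using G_F_3_pair[OF u(1) v(1) uv] u v by (simp add: G)
    finally have minus: "(\<Sum>j<N. (p j u - p j v)\<^sup>2) = 4" .
    \<comment> \<open>The values \<open>1\<close>, \<open>1\<close> and \<open>4\<close> of \<open>G\<^sub>F\<close> at \<open>u\<close>, \<open>v\<close> and \<open>u + P\<^sub>0 v\<close> leave nothing for
      the sum of the squares of \<open>p j u + p j v\<close>.\<close>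
    have "(\<Sum>j<N. (p j u + p j v)\<^sup>2) + (\<Sum>j<N. (p j u - p j v)\<^sup>2) =
        2 * (\<Sum>j<N. (p j u)\<^sup>2) + 2 * (\<Sum>j<N. (p j v)\<^sup>2)"
      by (simp add: sum_distrib_left power2_eq_square algebra_simps flip: sum.distrib)
    then have "(\<Sum>j<N. (p j u + p j v)\<^sup>2) = 0"
      using minus unit[OF u] unit[OF v] by simp
    then have "(p i u + p i v)\<^sup>2 = 0"
      using i by (subst (asm) sum_nonneg_eq_0_iff) auto
    then show ?thesis by simp
  qed
  have "p i x = 0" if "i < N" for i
    using opposite[OF x y xy that] opposite[OF x z xz that] opposite[OF y z yz that] by simp
  then show False
    using unit[OF x] by simp
qed

text \<open>
  Summands change sign under \<open>P\<^sub>4\<close> and are invariant under the volume element, so if these two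
  agree up to sign then every summand vanishes.  But \<open>G\<^sub>F\<close> is not zero: the additional form
  \<open>\<langle>P\<^sub>4 z, z\<rangle>\<close> also vanishes at \<open>z = x + P\<^sub>0 y\<close>.
\<close>

lemma not_sum_of_squares_definite:
  assumes m: "m = 4" and big: "4 < dim fixed_space"
    and P4: "\<And>x. P 4 *v x = c *\<^sub>R (volume *v x)" and c: "c = 1 \<or> c = - 1"
  shows "\<not> sum_of_squares_of_polynomials (G_F m P)"
proof
  assume "sum_of_squares_of_polynomials (G_F m P)"
  then obtain N :: nat and p where p: "\<forall>i<N. real_polynomial_function (p i)"
      and G: "\<forall>x. G_F m P x = (\<Sum>i<N. (p i x)\<^sup>2)"
    unfolding sum_of_squares_of_polynomials_def by blast
  have "p i x = 0" if i: "i < N" for i x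
  proof -
    have "p i 0 = 0"
      using summand_parallelogram[OF p G i, of 0 0] by simp
    then have even: "p i (- y) = p i y" for y
      using summand_parallelogram[OF p G i, of 0 y] by simp
    have "p i (P 4 *v x) = p i x"
      using c even by (auto simp: P4 summand_volume[OF p G i])
    moreover have "p i (P 4 *v x) = - p i x"
      using summand_P[OF p G i] m by simp
    ultimately show ?thesis by simp
  qed
  then have zero: "G_F m P x = 0" for x
    by (simp add: G)
  obtain x where x: "x \<in> fixed_space" "norm x = 1"
    using exists_in_fixed_space_orthogonal[of "{}"] big by auto
  obtain y where y: "y \<in> fixed_space" "norm y = 1"
      and xy: "\<And>\<alpha>. \<alpha> \<le> 3 \<Longrightarrow> (P \<alpha> *v x) \<bullet> (P 0 *v y) = 0"
    using exists_in_fixed_space_orthogonal[of "{x}"] big by auto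
  let ?z = "x + P 0 *v y"
  have fixed: "volume *v x = x" "volume *v y = y"
    using x y by (auto simp: fixed_space_def)
  have "(volume *v ?z) \<bullet> ?z = (x - P 0 *v y) \<bullet> (x + P 0 *v y)"
    using fixed by (simp add: volume_P_anticommute matrix_vector_right_distrib)
  also have "\<dots> = x \<bullet> x - y \<bullet> y"
    by (simp add: inner_diff_left inner_add_right P_inner_P inner_commute[of "P 0 *v y" x])
  also have "\<dots> = 0"
    using x y by (simp add: dot_square_norm)
  finally have "(P 4 *v ?z) \<bullet> ?z = 0"
    by (simp add: P4)
  then have "G_F m P ?z = 4"
    using G_F_3_pair[OF x(1) y(1) xy] x y m G_F_eq_G_F_3[of ?z] by simp
  then show False
    using zero by simp
qed

end

section \<open>Lagrange identities for two and three members\<close>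

definition wedge :: "real^'n \<Rightarrow> real^'n \<Rightarrow> real^'n^'n" where
  "wedge x y = (\<chi> i j. x $ i * y $ j - x $ j * y $ i)"

lemma inner_wedge: "wedge a b \<bullet> wedge c d = 2 * ((a \<bullet> c) * (b \<bullet> d) - (a \<bullet> d) * (b \<bullet> c))"
proof -
  have 1: "(\<Sum>i\<in>UNIV. \<Sum>j\<in>UNIV. (a $ i * b $ j) * (c $ i * d $ j)) = (a \<bullet> c) * (b \<bullet> d)"
    for a b c d :: "real^'n"
    by (simp add: inner_vec_def sum_product mult_ac)
  have 2: "(\<Sum>i\<in>UNIV. \<Sum>j\<in>UNIV. (a $ i * b $ j) * (c $ j * d $ i)) = (a \<bullet> d) * (b \<bullet> c)"
    for a b c d :: "real^'n"
    using 1[of a b d c] by (simp add: mult_ac)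
  have 3: "(\<Sum>i\<in>UNIV. \<Sum>j\<in>UNIV. (a $ j * b $ i) * (c $ j * d $ i)) = (a \<bullet> c) * (b \<bullet> d)"
    for a b c d :: "real^'n"
    using 1[of b a d c] by (simp add: mult_ac)
  have "wedge a b \<bullet> wedge c d =
    (\<Sum>i\<in>UNIV. \<Sum>j\<in>UNIV. (a $ i * b $ j) * (c $ i * d $ j)) -
    (\<Sum>i\<in>UNIV. \<Sum>j\<in>UNIV. (a $ i * b $ j) * (c $ j * d $ i)) -
    (\<Sum>i\<in>UNIV. \<Sum>j\<in>UNIV. (c $ i * d $ j) * (a $ j * b $ i)) +
    (\<Sum>i\<in>UNIV. \<Sum>j\<in>UNIV. (a $ j * b $ i) * (c $ j * d $ i))"
    by (simp add: wedge_def inner_vec_def algebra_simps flip: sum.distrib sum_subtractf)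
  then show ?thesis
    unfolding 1 2 3 by (simp add: inner_commute algebra_simps)
qed

lemma real_polynomial_wedge:
  fixes A B :: "real^'n^'n"
  shows "real_polynomial_function (\<lambda>x. wedge (A *v x) (B *v x) $ i $ j)"
  unfolding wedge_def
  by (simp, intro real_polynomial_function_diff real_polynomial_function.intros(4)
      real_polynomial_matrix_entry)

context clifford_system
begin

text \<open>
  Every \<open>x\<close> is \<open>u + P\<^sub>1 v\<close> for unique \<open>u\<close>, \<open>v\<close> in the \<open>+1\<close> eigenspace of \<open>P\<^sub>0\<close>; these matrices
  compute \<open>u\<close> and \<open>v\<close>.
\<close>

definition upper :: "real^'n^'n" where
  "upper = (1/2) *\<^sub>R (mat 1 + P 0)"

definition lower :: "real^'n^'n" where
  "lower = (1/2) *\<^sub>R (P 1 ** (mat 1 - P 0))"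

lemma upper_lower:
  assumes "1 \<le> m"
  shows "x = upper *v x + P 1 *v (lower *v x)"
    and "P 0 *v (upper *v x) = upper *v x" "P 0 *v (lower *v x) = lower *v x"
proof -
  have u: "upper *v x = (1/2) *\<^sub>R (x + P 0 *v x)"
    by (simp add: upper_def scaleR_matrix_vector_assoc[symmetric] matrix_vector_mult_add_rdistrib)
  have v: "lower *v x = (1/2) *\<^sub>R (P 1 *v (x - P 0 *v x))"
    by (simp add: lower_def scaleR_matrix_vector_assoc[symmetric] matrix_vector_mult_diff_rdistrib
        flip: matrix_vector_mul_assoc)
  have "P 0 *v (P 1 *v y) = - (P 1 *v (P 0 *v y))" for y
    using assms by (intro P_anticommute) auto
  then show "P 0 *v (upper *v x) = upper *v x" "P 0 *v (lower *v x) = lower *v x"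
    by (simp_all add: u v matrix_vector_mult_scaleR matrix_vector_right_distrib
        matrix_vector_mult_diff_distrib algebra_simps)
  show "x = upper *v x + P 1 *v (lower *v x)"
    using assms
    by (simp add: u v matrix_vector_mult_scaleR matrix_vector_right_distrib
        matrix_vector_mult_diff_distrib flip: scaleR_add_right)
qed

lemma quadratic_forms_upper_lower:
  fixes x
  assumes "1 \<le> m"
  defines "u \<equiv> upper *v x" and "v \<equiv> lower *v x"
  shows "norm x ^ 4 = (u \<bullet> u + v \<bullet> v)\<^sup>2"
    and "(P 0 *v x) \<bullet> x = u \<bullet> u - v \<bullet> v"
    and "(P 1 *v x) \<bullet> x = 2 * (u \<bullet> v)"
    and "2 \<le> m \<Longrightarrow> (P 2 *v x) \<bullet> x = 2 * (u \<bullet> (P 2 *v (P 1 *v v)))"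
proof -
  have x: "x = u + P 1 *v v" and u: "P 0 *v u = u" and v: "P 0 *v v = v"
    unfolding u_def v_def by (rule upper_lower[OF assms(1)])+
  have anti: "P 0 *v (P \<alpha> *v y) = - (P \<alpha> *v (P 0 *v y))" if "0 < \<alpha>" "\<alpha> \<le> m" for \<alpha> y
    using that by (intro P_anticommute) auto
  have zero: "(P \<alpha> *v y) \<bullet> z = 0"
    if "0 < \<alpha>" "\<alpha> \<le> m" "P 0 *v y = y" "P 0 *v z = z" for \<alpha> y z
  proof -
    have "(P \<alpha> *v y) \<bullet> z = (P 0 *v (P \<alpha> *v y)) \<bullet> z"
      using P_inner[of 0 "P \<alpha> *v y" z] that(4) by simp
    then show ?thesis
      using anti[OF that(1,2), of y] that by simp
  qed
  have z1: "(P 1 *v v) \<bullet> u = 0" "u \<bullet> (P 1 *v v) = 0" "(P 1 *v u) \<bullet> u = 0" "(P 1 *v v) \<bullet> v = 0"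
    using assms(1) u v zero[of 1] by (auto simp: inner_commute)
  have "x \<bullet> x = u \<bullet> u + v \<bullet> v"
    using assms(1) z1 P_inner_P[of 1 v v] by (simp add: x inner_add_left inner_add_right)
  then show "norm x ^ 4 = (u \<bullet> u + v \<bullet> v)\<^sup>2"
    by (metis (no_types) dot_square_norm mult_2 numeral_Bit0 power_mult power2_norm_eq_inner
        power_even_eq mult.commute)
  show "(P 0 *v x) \<bullet> x = u \<bullet> u - v \<bullet> v"
    using assms(1) z1 P_inner_P[of 1 v v] anti[of 1 v] u v
    by (simp add: x inner_diff_left inner_add_left inner_add_right matrix_vector_right_distrib)
  show "(P 1 *v x) \<bullet> x = 2 * (u \<bullet> v)"
    using assms(1) z1 P_inner_P[of 1 u v] inner_commute[of v u] inner_commute[of v "P 1 *v v"]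
    by (simp add: x inner_add_left inner_add_right matrix_vector_right_distrib)
  assume m: "2 \<le> m"
  have "(P 2 *v u) \<bullet> u = 0"
    using m u zero[of 2] by auto
  moreover have "(P 2 *v (P 1 *v v)) \<bullet> (P 1 *v v) = 0"
    using P_anticommute[of 2 1 v] m v zero[of 2 v v] P_inner_P[of 1 "P 2 *v v" v] by simp
  moreover have "(P 2 *v u) \<bullet> (P 1 *v v) = u \<bullet> (P 2 *v (P 1 *v v))"
    using m by (simp add: P_inner)
  moreover have "(P 2 *v (P 1 *v v)) \<bullet> u = u \<bullet> (P 2 *v (P 1 *v v))"
    by (rule inner_commute)
  ultimately show "(P 2 *v x) \<bullet> x = 2 * (u \<bullet> (P 2 *v (P 1 *v v)))"
    by (simp add: x inner_add_left inner_add_right matrix_vector_right_distrib)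
qed

text \<open>
  Here \<open>G\<^sub>F = 4 (|u|\<^sup>2 |v|\<^sup>2 - \<langle>u, v\<rangle>\<^sup>2)\<close>, which Lagrange's identity writes through the
  \<open>2 \<times> 2\<close> minors of \<open>u\<close> and \<open>v\<close>.
\<close>

lemma sum_of_squares_m_eq_1:
  assumes m: "m = 1"
  shows "sum_of_squares_of_polynomials (G_F m P)"
proof -
  let ?Q = "\<lambda>x. wedge (upper *v x) (lower *v x)"
  have "G_F m P x = 2 * (?Q x \<bullet> ?Q x)" for x
  proof -
    have "(\<Sum>\<alpha>=0..m. ((P \<alpha> *v x) \<bullet> x)\<^sup>2) = ((P 0 *v x) \<bullet> x)\<^sup>2 + ((P 1 *v x) \<bullet> x)\<^sup>2"
      using m by simp
    then show ?thesis
      unfolding G_F_def quadratic_forms_upper_lower(1-3)[OF eq_refl[OF m[symmetric]], of x]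
      by (simp add: quadratic_forms_upper_lower(1-3)[OF eq_refl[OF m[symmetric]], of x]
          inner_wedge power2_eq_square algebra_simps inner_commute[of "lower *v x" "upper *v x"])
  qed
  then have "G_F m P = (\<lambda>x. 2 * (?Q x \<bullet> ?Q x))"
    by blast
  moreover have "sum_of_squares_of_polynomials (\<lambda>x. 2 * (?Q x \<bullet> ?Q x))"
    by (rule sum_of_squares_matrix[OF real_polynomial_wedge]) simp
  ultimately show ?thesis by simp
qed

text \<open>
  Now \<open>G\<^sub>F = 4 (|u|\<^sup>2 |v|\<^sup>2 - \<langle>u, v\<rangle>\<^sup>2 - \<langle>u, J v\<rangle>\<^sup>2)\<close> for the complex structure
  \<open>J = P\<^sub>2 P\<^sub>1\<close> on the eigenspace.  The complex Lagrange identity uses the complex bilinear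
  part of \<open>u \<and> v\<close>, and this part is a multiple of \<open>u \<and> v - J u \<and> J v\<close>.
\<close>

lemma sum_of_squares_m_eq_2:
  assumes m: "m = 2"
  shows "sum_of_squares_of_polynomials (G_F m P)"
proof -
  let ?J = "P 2 ** P 1"
  let ?Q = "\<lambda>x. wedge (upper *v x) (lower *v x) - wedge (?J ** upper *v x) (?J ** lower *v x)"
  have "G_F m P x = 1 * (?Q x \<bullet> ?Q x)" for x
  proof -
    define u v where "u = upper *v x" and "v = lower *v x"
    have J: "(P 2 *v (P 1 *v y)) \<bullet> (P 2 *v (P 1 *v z)) = y \<bullet> z" for y z
      using m by (simp add: P_inner_P)
    have "{0..m} = {0, 1, 2}"
      using m by auto
    then have "(\<Sum>\<alpha>=0..m. ((P \<alpha> *v x) \<bullet> x)\<^sup>2) =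
        ((P 0 *v x) \<bullet> x)\<^sup>2 + ((P 1 *v x) \<bullet> x)\<^sup>2 + ((P 2 *v x) \<bullet> x)\<^sup>2"
      by simp
    then have G: "G_F m P x =
        4 * ((u \<bullet> u) * (v \<bullet> v) - (u \<bullet> v)\<^sup>2 - (u \<bullet> (P 2 *v (P 1 *v v)))\<^sup>2)"
      using quadratic_forms_upper_lower[of x] m
      by (simp add: G_F_def u_def v_def power2_eq_square algebra_simps)
    have skew: "v \<bullet> (P 2 *v (P 1 *v u)) = - (u \<bullet> (P 2 *v (P 1 *v v)))"
    proof -
      have "v \<bullet> (P 2 *v (P 1 *v u)) = (P 1 *v (P 2 *v v)) \<bullet> u"
        using m by (simp add: P_inner)
      also have "\<dots> = - (u \<bullet> (P 2 *v (P 1 *v v)))"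
        using m P_anticommute[of 1 2 v] by (simp add: inner_commute)
      finally show ?thesis .
    qed
    have self: "y \<bullet> (P 2 *v (P 1 *v y)) = 0" for y
      using m by (intro inner_PP_self) auto
    let ?Ju = "P 2 *v (P 1 *v u)" and ?Jv = "P 2 *v (P 1 *v v)"
    have "?Q x = wedge u v - wedge ?Ju ?Jv"
      by (simp add: u_def v_def flip: matrix_vector_mul_assoc)
    then have "?Q x \<bullet> ?Q x = wedge u v \<bullet> wedge u v + wedge ?Ju ?Jv \<bullet> wedge ?Ju ?Jv
        - 2 * (wedge u v \<bullet> wedge ?Ju ?Jv)"
      by (simp add: inner_diff_left inner_diff_right inner_commute)
    then show ?thesis
      unfolding G inner_wedge J self skew by (simp add: power2_eq_square algebra_simps inner_commute)
  qed
  then have "G_F m P = (\<lambda>x. 1 * (?Q x \<bullet> ?Q x))"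
    by blast
  moreover have "sum_of_squares_of_polynomials (\<lambda>x. 1 * (?Q x \<bullet> ?Q x))"
    by (rule sum_of_squares_matrix)
       (auto simp only: vector_minus_component intro!: real_polynomial_function_diff real_polynomial_wedge)
  ultimately show ?thesis by simp
qed

end

section \<open>Frobenius inner products and rank-one matrices\<close>

definition outer :: "real^'n \<Rightarrow> real^'n^'n" where
  "outer x = (\<chi> i j. x $ i * x $ j)"

lemma inner_outer: "outer x \<bullet> A = x \<bullet> (A *v x)"
  by (simp add: outer_def inner_vec_def matrix_vector_mult_def sum_distrib_left mult_ac)

lemma outer_mult_vec: "outer y *v x = (y \<bullet> x) *\<^sub>R y"
  by (simp add: outer_def vec_eq_iff matrix_vector_mult_def inner_vec_def sum_distrib_left mult_ac)

lemma inner_outer_outer: "outer x \<bullet> outer y = (x \<bullet> y)\<^sup>2"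
  by (simp add: inner_outer outer_mult_vec power2_eq_square inner_commute)

lemma inner_matrix_mult_left: "(M ** A) \<bullet> B = A \<bullet> (transpose M ** B)" for A B M :: "real^'n^'n"
proof -
  have "(M ** A) \<bullet> B = (\<Sum>i\<in>UNIV. \<Sum>j\<in>UNIV. \<Sum>k\<in>UNIV. M $ i $ k * A $ k $ j * B $ i $ j)"
    by (simp add: inner_vec_def matrix_matrix_mult_def sum_distrib_right)
  also have "\<dots> = (\<Sum>i\<in>UNIV. \<Sum>k\<in>UNIV. \<Sum>j\<in>UNIV. M $ i $ k * A $ k $ j * B $ i $ j)"
    by (intro sum.cong refl sum.swap)
  also have "\<dots> = (\<Sum>k\<in>UNIV. \<Sum>i\<in>UNIV. \<Sum>j\<in>UNIV. M $ i $ k * A $ k $ j * B $ i $ j)"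
    by (rule sum.swap)
  also have "\<dots> = (\<Sum>k\<in>UNIV. \<Sum>j\<in>UNIV. \<Sum>i\<in>UNIV. M $ i $ k * A $ k $ j * B $ i $ j)"
    by (intro sum.cong refl sum.swap)
  also have "\<dots> = A \<bullet> (transpose M ** B)"
    by (simp add: inner_vec_def matrix_matrix_mult_def transpose_def sum_distrib_left mult_ac)
  finally show ?thesis .
qed

lemma inner_transpose: "transpose A \<bullet> transpose B = A \<bullet> B" for A B :: "real^'n^'n"
  unfolding inner_vec_def by (simp add: transpose_def sum.swap[of "\<lambda>i j. A $ j $ i * B $ j $ i"])

lemma inner_matrix_mult_right: "(A ** M) \<bullet> B = A \<bullet> (B ** transpose M)" for A B M :: "real^'n^'n"
proof -
  have "(A ** M) \<bullet> B = (transpose M ** transpose A) \<bullet> transpose B"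
    by (metis inner_transpose matrix_transpose_mul)
  also have "\<dots> = transpose A \<bullet> (M ** transpose B)"
    by (simp add: inner_matrix_mult_left)
  also have "\<dots> = A \<bullet> (B ** transpose M)"
    by (metis inner_transpose matrix_transpose_mul transpose_transpose)
  finally show ?thesis .
qed

lemma inner_isometric_matrix:
  fixes A :: "real^'n^'n"
  assumes "\<And>x. (A *v x) \<bullet> (A *v x) = x \<bullet> x"
  shows "A \<bullet> A = CARD('n)"
proof -
  have "A \<bullet> A = (\<Sum>b\<in>(Basis :: (real^'n) set). (A *v b) \<bullet> (A *v b))"
    by (rule inner_matrix_orthonormal_basis)
       (auto simp: pairwise_def orthogonal_def inner_not_same_Basis)
  also have "\<dots> = (\<Sum>b\<in>(Basis :: (real^'n) set). 1)"
    using assms by (intro sum.cong) auto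
  finally show ?thesis by simp
qed

text \<open>
  Pythagoras for the removal of the components along an orthogonal family of vectors of equal
  length.
\<close>

lemma inner_self_diff_projection:
  fixes y :: "'a::real_inner"
  assumes "finite I" "k \<noteq> 0" and c: "\<And>i j. i \<in> I \<Longrightarrow> j \<in> I \<Longrightarrow> c i \<bullet> c j = (if i = j then k else 0)"
  defines "r \<equiv> y - (\<Sum>i\<in>I. ((y \<bullet> c i) / k) *\<^sub>R c i)"
  shows "r \<bullet> r = y \<bullet> y - (\<Sum>i\<in>I. (y \<bullet> c i)\<^sup>2) / k"
proof -
  have "r \<bullet> c j = 0" if "j \<in> I" for j
  proof -
    have "(\<Sum>i\<in>I. ((y \<bullet> c i) / k) *\<^sub>R c i) \<bullet> c j = (\<Sum>i\<in>I. if i = j then y \<bullet> c j else 0)"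
      unfolding inner_sum_left using that assms(2) by (intro sum.cong) (auto simp: c)
    then show ?thesis
      using that assms(1) by (simp add: r_def inner_diff_left)
  qed
  then have "r \<bullet> (\<Sum>i\<in>I. ((y \<bullet> c i) / k) *\<^sub>R c i) = 0"
    by (simp add: inner_sum_right)
  then have "r \<bullet> r = r \<bullet> y"
    by (subst (2) r_def) (simp add: inner_diff_right)
  also have "\<dots> = y \<bullet> y - (\<Sum>i\<in>I. (y \<bullet> c i)\<^sup>2 / k)"
  proof -
    have "c i \<bullet> y = y \<bullet> c i" for i
      by (rule inner_commute)
    then show ?thesis
      by (simp add: r_def inner_diff_left inner_sum_left power2_eq_square)
  qed
  finally show ?thesis by (simp add: sum_divide_distrib)
qed

lemma neg_matrix_vector_mult [simp]: "(- A) *v x = - (A *v x)" for A :: "real^'n^'n"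
  using matrix_vector_mult_diff_rdistrib[of 0 A x] by simp

section \<open>Projecting rank-one matrices to the anticommutant\<close>

context clifford_system_ge3
begin

text \<open>
  Twice the orthogonal projection of a matrix to those anticommuting with \<open>P\<^sub>\<alpha>\<close>.  The composition
  of the four commuting maps for \<open>\<alpha> \<le> 3\<close> is therefore sixteen times a projection.
\<close>

definition anti_part :: "nat \<Rightarrow> real^'n^'n \<Rightarrow> real^'n^'n" where
  "anti_part \<alpha> A = A - P \<alpha> ** A ** P \<alpha>"

lemma anti_part_mult_vec: "anti_part \<alpha> A *v x = A *v x - P \<alpha> *v (A *v (P \<alpha> *v x))"
  by (simp add: anti_part_def matrix_vector_mult_diff_rdistrib flip: matrix_vector_mul_assoc)

lemma anti_part_diff: "anti_part \<alpha> (A - B) = anti_part \<alpha> A - anti_part \<alpha> B"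
  unfolding matrix_eq
  by (simp add: anti_part_mult_vec matrix_vector_mult_diff_rdistrib matrix_vector_mult_diff_distrib)

lemma anti_part_scaleR: "anti_part \<alpha> (c *\<^sub>R A) = c *\<^sub>R anti_part \<alpha> A"
  unfolding matrix_eq
  by (simp add: anti_part_mult_vec scaleR_matrix_vector_assoc[symmetric] matrix_vector_mult_scaleR
      scaleR_diff_right)

lemma conj_inner:
  assumes "\<alpha> \<le> m"
  shows "(P \<alpha> ** A ** P \<alpha>) \<bullet> B = A \<bullet> (P \<alpha> ** B ** P \<alpha>)"
  using inner_matrix_mult_right[of "P \<alpha> ** A" "P \<alpha>" B]
    inner_matrix_mult_left[of "P \<alpha>" A "B ** P \<alpha>"]
  by (simp only: P_sym[OF assms] matrix_mul_assoc)

lemma conj_conj: "\<alpha> \<le> m \<Longrightarrow> P \<alpha> ** (P \<alpha> ** A ** P \<alpha>) ** P \<alpha> = A"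
  by (simp add: matrix_eq flip: matrix_vector_mul_assoc)

lemma anti_part_inner: "\<alpha> \<le> m \<Longrightarrow> anti_part \<alpha> A \<bullet> B = A \<bullet> anti_part \<alpha> B"
  by (simp add: anti_part_def inner_diff_left inner_diff_right conj_inner)

lemma anti_part_idem:
  assumes "\<alpha> \<le> m"
  shows "anti_part \<alpha> (anti_part \<alpha> A) = 2 *\<^sub>R anti_part \<alpha> A"
proof -
  have "anti_part \<alpha> (anti_part \<alpha> A) = anti_part \<alpha> A - anti_part \<alpha> (P \<alpha> ** A ** P \<alpha>)"
    using anti_part_diff[of \<alpha> A "P \<alpha> ** A ** P \<alpha>"] by (simp only: anti_part_def[of \<alpha> A])
  also have "anti_part \<alpha> (P \<alpha> ** A ** P \<alpha>) = - anti_part \<alpha> A"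
    by (simp only: anti_part_def conj_conj[OF assms] minus_diff_eq)
  finally show ?thesis
    by (simp only: scaleR_2 diff_minus_eq_add)
qed

lemma anti_part_commute:
  assumes "\<alpha> \<le> m" "\<beta> \<le> m"
  shows "anti_part \<alpha> (anti_part \<beta> A) = anti_part \<beta> (anti_part \<alpha> A)"
proof (cases "\<alpha> = \<beta>")
  case False
  note P_anticommute[OF assms this]
  then show ?thesis
    unfolding matrix_eq
    by (simp add: anti_part_mult_vec matrix_vector_mult_diff_distrib matrix_vector_right_distrib)
qed simp

lemma anti_part_outer: "\<alpha> \<le> m \<Longrightarrow> anti_part \<alpha> (outer y) = outer y - outer (P \<alpha> *v y)"
  unfolding matrix_eq
  by (simp add: anti_part_mult_vec matrix_vector_mult_diff_rdistrib outer_mult_vec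
      matrix_vector_mult_scaleR P_inner)

lemma anti_part_anticommuting:
  assumes "\<alpha> \<le> m" "\<And>x. A *v (P \<alpha> *v x) = - (P \<alpha> *v (A *v x))"
  shows "anti_part \<alpha> A = 2 *\<^sub>R A"
proof -
  have "P \<alpha> ** A ** P \<alpha> = - A"
    using assms by (simp add: matrix_eq flip: matrix_vector_mul_assoc)
  then show ?thesis
    by (simp only: anti_part_def scaleR_2 diff_minus_eq_add)
qed

definition anti_outer :: "real^'n \<Rightarrow> real^'n^'n" where
  "anti_outer x = anti_part 0 (anti_part 1 (anti_part 2 (anti_part 3 (outer x))))"

lemma anti_part_sort:
  "anti_part 1 (anti_part 0 A) = anti_part 0 (anti_part 1 A)"
  "anti_part 2 (anti_part 0 A) = anti_part 0 (anti_part 2 A)"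
  "anti_part 3 (anti_part 0 A) = anti_part 0 (anti_part 3 A)"
  "anti_part 2 (anti_part 1 A) = anti_part 1 (anti_part 2 A)"
  "anti_part 3 (anti_part 1 A) = anti_part 1 (anti_part 3 A)"
  "anti_part 3 (anti_part 2 A) = anti_part 2 (anti_part 3 A)"
  by (rule anti_part_commute; use three_le in simp)+

text \<open>
  Expanding the four operators produces, up to sign, \<open>\<langle>x, P\<^sub>I x\<rangle>\<^sup>2\<close> for the sixteen ordered products
  \<open>P\<^sub>I\<close> of the first four members.  Products of two or three factors are skew and drop out; the
  product of all four contributes the volume element.
\<close>

lemma outer_inner_anti_outer:
  "outer x \<bullet> anti_outer x = norm x ^ 4 - (\<Sum>\<alpha>=0..3. ((P \<alpha> *v x) \<bullet> x)\<^sup>2) + ((volume *v x) \<bullet> x)\<^sup>2"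
proof -
  have two: "x \<bullet> (P \<alpha> *v (P \<beta> *v x)) = 0" if "\<alpha> < \<beta>" "\<beta> \<le> 3" for \<alpha> \<beta>
    using that three_le by (intro inner_PP_self) auto
  have three: "x \<bullet> (P 0 *v (P 1 *v (P 2 *v x))) = 0" "x \<bullet> (P 0 *v (P 1 *v (P 3 *v x))) = 0"
    "x \<bullet> (P 0 *v (P 2 *v (P 3 *v x))) = 0" "x \<bullet> (P 1 *v (P 2 *v (P 3 *v x))) = 0"
  proof -
    have neg: "r = 0" if "r = - r" for r :: real
      using that by simp
    have *: "x \<bullet> y = y \<bullet> x" for y
      by (rule inner_commute)
    show "x \<bullet> (P 0 *v (P 1 *v (P 2 *v x))) = 0"
      using three_le by (intro neg, subst *) (simp add: P_inner P_sort P_sort[simplified])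
    show "x \<bullet> (P 0 *v (P 1 *v (P 3 *v x))) = 0"
      using three_le by (intro neg, subst *) (simp add: P_inner P_sort P_sort[simplified])
    show "x \<bullet> (P 0 *v (P 2 *v (P 3 *v x))) = 0"
      using three_le by (intro neg, subst *) (simp add: P_inner P_sort P_sort[simplified])
    show "x \<bullet> (P 1 *v (P 2 *v (P 3 *v x))) = 0"
      using three_le by (intro neg, subst *) (simp add: P_inner P_sort P_sort[simplified])
  qed
  have "{0..3::nat} = {0, 1, 2, 3}" by auto
  then have sum: "(\<Sum>\<alpha>=0..3. ((P \<alpha> *v x) \<bullet> x)\<^sup>2) = (x \<bullet> (P 0 *v x))\<^sup>2 + (x \<bullet> (P 1 *v x))\<^sup>2
      + (x \<bullet> (P 2 *v x))\<^sup>2 + (x \<bullet> (P 3 *v x))\<^sup>2"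
    by (simp add: inner_commute)
  have four: "norm x ^ 4 = (x \<bullet> x)\<^sup>2"
    by (simp add: dot_square_norm flip: power_mult)
  have vol: "(volume *v x) \<bullet> x = x \<bullet> (P 0 *v (P 1 *v (P 2 *v (P 3 *v x))))"
    by (simp add: volume_apply inner_commute)
  note two' = two[of 0 1] two[of 0 2] two[of 0 3] two[of 1 2] two[of 1 3] two[of 2 3]
  show ?thesis
    unfolding sum four vol anti_outer_def using three_le
    by (simp add: anti_part_outer anti_part_diff inner_diff_right inner_outer_outer two' two'[simplified]
        three three[simplified])
qed

lemma anti_outer_inner_anti_outer:
  "anti_outer x \<bullet> anti_outer x = 16 * (G_F 3 P x + ((volume *v x) \<bullet> x)\<^sup>2)"
proof -
  let ?F = "\<lambda>A. anti_part 0 (anti_part 1 (anti_part 2 (anti_part 3 A)))"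
  have adj: "?F A \<bullet> B = A \<bullet> ?F B" for A B
    using three_le by (simp add: anti_part_inner anti_part_sort anti_part_sort[simplified])
  have "?F (?F A) = 16 *\<^sub>R ?F A" for A
    using three_le by (simp add: anti_part_sort anti_part_sort[simplified] anti_part_idem anti_part_scaleR)
  then have "anti_outer x \<bullet> anti_outer x = 16 * (outer x \<bullet> anti_outer x)"
    unfolding anti_outer_def adj by simp
  then show ?thesis
    by (simp add: outer_inner_anti_outer G_F_def)
qed

lemma anti_outer_inner_anticommuting:
  assumes "\<And>\<alpha> x. \<alpha> \<le> 3 \<Longrightarrow> A *v (P \<alpha> *v x) = - (P \<alpha> *v (A *v x))"
  shows "anti_outer x \<bullet> A = 16 * ((A *v x) \<bullet> x)"
proof -
  have "anti_part \<alpha> A = 2 *\<^sub>R A" if "\<alpha> \<le> 3" for \<alpha>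
    using that three_le assms by (intro anti_part_anticommuting) auto
  note this[of 0] this[of 1] this[of 2] this[of 3]
  from this this[simplified] have "anti_outer x \<bullet> A = outer x \<bullet> (16 *\<^sub>R A)"
    unfolding anti_outer_def using three_le by (simp add: anti_part_inner anti_part_scaleR)
  then show ?thesis
    by (simp add: inner_outer inner_commute[of x "A *v x"])
qed

lemma inner_conj:
  "\<beta> \<le> m \<Longrightarrow> (P \<beta> ** A ** P \<beta>) \<bullet> (P \<beta> ** B ** P \<beta>) = A \<bullet> B"
  by (simp only: conj_inner conj_conj)

text \<open>
  Conjugation by \<open>P\<^sub>\<beta>\<close> is an isometry that fixes \<open>A\<close> and negates \<open>B\<close>.
\<close>

lemma inner_eq_0_by_conj:
  assumes "\<beta> \<le> m" "\<And>x. A *v (P \<beta> *v x) = P \<beta> *v (A *v x)"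
    "\<And>x. B *v (P \<beta> *v x) = - (P \<beta> *v (B *v x))"
  shows "A \<bullet> B = 0"
proof -
  have "P \<beta> ** A ** P \<beta> = A" "P \<beta> ** B ** P \<beta> = - B"
    using assms by (simp_all add: matrix_eq flip: matrix_vector_mul_assoc)
  then show ?thesis
    using inner_conj[OF assms(1), of A B] by simp
qed

text \<open>
  The volume element and \<open>P\<^sub>4, \<dots>, P\<^sub>m\<close> anticommute with the first four members, so the projected
  rank-one matrix of \<open>x\<close> has inner products with them equal to the values of their forms at \<open>x\<close>.
  They all have squared length \<open>16\<close>, the ambient dimension.  This matches the factor \<open>1/16\<close> in the
  squared length of the projection: removing the components along them cancels the unwanted
  square of the volume form and subtracts precisely the squares that distinguish \<open>G\<^sub>F\<close> from
  its value for \<open>m = 3\<close>.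
\<close>

lemma sum_of_squares_if_orthogonal:
  assumes card: "CARD('n) = 16" and orth: "\<And>\<alpha>. 4 \<le> \<alpha> \<Longrightarrow> \<alpha> \<le> m \<Longrightarrow> volume \<bullet> P \<alpha> = 0"
  shows "sum_of_squares_of_polynomials (G_F m P)"
proof -
  \<comment> \<open>The index \<open>3\<close> is free to stand for the volume element.\<close>
  define c where "c \<alpha> = (if \<alpha> = 3 then volume else P \<alpha>)" for \<alpha>
  have anti: "c \<alpha> *v (P \<beta> *v x) = - (P \<beta> *v (c \<alpha> *v x))" if "\<alpha> \<in> {3..m}" "\<beta> \<le> 3" for \<alpha> \<beta> x
    using that by (auto simp: c_def volume_P_anticommute intro!: P_anticommute)
  have c_orth: "c \<alpha> \<bullet> c \<beta> = (if \<alpha> = \<beta> then 16 else 0)" if "\<alpha> \<in> {3..m}" "\<beta> \<in> {3..m}" for \<alpha> \<beta>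
  proof -
    have "c \<alpha> \<bullet> c \<alpha> = CARD('n)"
      using that by (intro inner_isometric_matrix) (auto simp: c_def volume_inner P_inner)
    moreover have "P \<alpha> \<bullet> P \<beta> = 0" if "\<alpha> \<noteq> \<beta>" "\<alpha> \<le> m" "\<beta> \<le> m" for \<alpha> \<beta>
      using that by (intro inner_eq_0_by_conj[of \<alpha>]) (auto intro: P_anticommute)
    ultimately show ?thesis
      using that orth[of \<alpha>] orth[of \<beta>] card by (auto simp: c_def inner_commute)
  qed
  define Q where
    "Q x = (1/16) *\<^sub>R anti_outer x - (\<Sum>\<alpha>=3..m. (((1/16) *\<^sub>R anti_outer x \<bullet> c \<alpha>) / 16) *\<^sub>R c \<alpha>)" for x
  have coeff: "(1/16) *\<^sub>R anti_outer x \<bullet> c \<alpha> = (c \<alpha> *v x) \<bullet> x" if "\<alpha> \<in> {3..m}" for x \<alpha>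
    using anti_outer_inner_anticommuting[of "c \<alpha>" x] anti[OF that] by simp
  have "G_F m P x = 16 * (Q x \<bullet> Q x)" for x
  proof -
    have "Q x \<bullet> Q x = (1/16) *\<^sub>R anti_outer x \<bullet> (1/16) *\<^sub>R anti_outer x - (\<Sum>\<alpha>=3..m. ((1/16) *\<^sub>R anti_outer x \<bullet> c \<alpha>)\<^sup>2) / 16"
      unfolding Q_def by (rule inner_self_diff_projection) (auto simp: c_orth)
    also have "(\<Sum>\<alpha>=3..m. ((1/16) *\<^sub>R anti_outer x \<bullet> c \<alpha>)\<^sup>2) = (\<Sum>\<alpha>=3..m. ((c \<alpha> *v x) \<bullet> x)\<^sup>2)"
      by (intro sum.cong) (simp_all only: coeff)
    also have "\<dots> = ((volume *v x) \<bullet> x)\<^sup>2 + (\<Sum>\<alpha>=4..m. ((P \<alpha> *v x) \<bullet> x)\<^sup>2)"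
      using three_le by (simp add: sum.atLeast_Suc_atMost c_def)
    finally show ?thesis
      by (simp add: anti_outer_inner_anti_outer G_F_eq_G_F_3[of x] field_simps)
  qed
  then have "G_F m P = (\<lambda>x. 16 * (Q x \<bullet> Q x))"
    by blast
  moreover have "real_polynomial_function (\<lambda>x. Q x $ i $ j)" for i j
  proof -
    have anti_part_poly: "real_polynomial_function (\<lambda>x. anti_part \<alpha> (M x) $ i $ j)"
      if "\<And>i j. real_polynomial_function (\<lambda>x. M x $ i $ j)" for \<alpha> i j and M :: "real^'n \<Rightarrow> real^'n^'n"
      unfolding anti_part_def matrix_matrix_mult_def
      by (simp, intro real_polynomial_function_diff real_polynomial_function_sum
          real_polynomial_function.intros(2,4) that finite)
    have outer_poly: "real_polynomial_function (\<lambda>x::real^'n. outer x $ i $ j)" for i j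
      unfolding outer_def using real_polynomial_matrix_entry[of "mat 1 :: real^'n^'n"]
      by (simp, intro real_polynomial_function.intros(4)) auto
    have anti_outer_poly: "real_polynomial_function (\<lambda>x. anti_outer x $ i $ j)" for i j
      unfolding anti_outer_def by (intro anti_part_poly outer_poly)
    have Q_eq: "Q x $ i $ j = (1/16) * anti_outer x $ i $ j
        - (\<Sum>\<alpha>=3..m. ((c \<alpha> *v x) \<bullet> x) * (c \<alpha> $ i $ j / 16))" for x
    proof -
      have "(\<Sum>\<alpha>=3..m. (((1/16) *\<^sub>R anti_outer x \<bullet> c \<alpha>) / 16) *\<^sub>R c \<alpha>) =
          (\<Sum>\<alpha>=3..m. (((c \<alpha> *v x) \<bullet> x) / 16) *\<^sub>R c \<alpha>)"
        by (intro sum.cong) (simp_all only: coeff)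
      then show ?thesis
        by (simp add: Q_def)
    qed
    show ?thesis
      unfolding Q_eq
      by (intro real_polynomial_function_diff real_polynomial_function_sum
          real_polynomial_function.intros(2,4) anti_outer_poly real_polynomial_matrix_form) auto
  qed
  ultimately show ?thesis
    using sum_of_squares_matrix[of Q 16] by simp
qed

text \<open>
  A fifth and a sixth member rule each other out as multiples of the volume element: conjugation by
  one of them fixes the volume element and negates the other.
\<close>

lemma volume_orthogonal_ge5:
  assumes "5 \<le> m" "4 \<le> \<alpha>" "\<alpha> \<le> m"
  shows "volume \<bullet> P \<alpha> = 0"
proof (rule inner_eq_0_by_conj)
  let ?\<beta> = "if \<alpha> = 4 then 5 else 4 :: nat"
  show "?\<beta> \<le> m" using assms by simp
  show "volume *v (P ?\<beta> *v x) = P ?\<beta> *v (volume *v x)" for x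
    using assms by (intro volume_P_commute) auto
  show "P \<alpha> *v (P ?\<beta> *v x) = - (P ?\<beta> *v (P \<alpha> *v x))" for x
    using assms by (intro P_anticommute) auto
qed

lemma definite_class_iff:
  assumes "m = 4"
  shows "definite_class P \<longleftrightarrow>
    (\<forall>x. P 4 *v x = volume *v x) \<or> (\<forall>x. P 4 *v x = - (volume *v x))"
proof -
  have prod: "P 0 ** P 1 ** P 2 ** P 3 ** P 4 = volume ** P 4"
    by (simp add: volume_def)
  have "volume *v (P 4 *v x) = x \<longleftrightarrow> P 4 *v x = volume *v x" for x
    by (metis volume_involution)
  moreover have "volume *v (P 4 *v x) = - x \<longleftrightarrow> P 4 *v x = - (volume *v x)" for x
    by (metis matrix_vector_mult_neg volume_involution)
  ultimately show ?thesis
    unfolding definite_class_def prod matrix_eq by (simp flip: matrix_vector_mul_assoc)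
qed

text \<open>
  The inner product is the trace of the involution \<open>P\<^sub>0 P\<^sub>1 P\<^sub>2 P\<^sub>3 P\<^sub>4\<close>.  Its eigenspaces \<open>V 1\<close>
  and \<open>V (-1)\<close> are invariant under \<open>P\<^sub>0, \<dots>, P\<^sub>3\<close>, hence have dimensions divisible by eight,
  and in the indefinite class neither is the whole space.  So both have dimension eight and the
  trace is zero.
\<close>

lemma volume_orthogonal_indefinite:
  assumes m: "m = 4" and card: "CARD('n) = 16" and indef: "indefinite_class P"
  shows "volume \<bullet> P 4 = 0"
proof -
  define V where "V s = {x. P 4 *v x = s *\<^sub>R (volume *v x)}" for s :: real
  have comm: "volume *v (P 4 *v x) = P 4 *v (volume *v x)" for x
    using m by (intro volume_P_commute) auto
  have sub: "subspace (V s)" for s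
    by (auto simp: V_def subspace_def matrix_vector_right_distrib matrix_vector_mult_scaleR algebra_simps)
  have inv: "(*v) (P \<alpha>) ` V s \<subseteq> V s" if "\<alpha> \<le> 3" for \<alpha> s
  proof -
    have "P 4 *v (P \<alpha> *v x) = - (P \<alpha> *v (P 4 *v x))" for x
      using that m by (intro P_anticommute) auto
    then show ?thesis
      using that by (auto simp: V_def volume_P_anticommute matrix_vector_mult_scaleR)
  qed
  have "dim (V s) = 2 * dim {x \<in> V s. volume *v x = x}" for s
    using inv[of 0 s]
    by (intro dim_invariant_eq sub) (auto simp: V_def comm[symmetric] matrix_vector_mult_scaleR)
  moreover have "4 dvd dim {x \<in> V s. volume *v x = x}" for s
    using inv by (intro four_dvd_dim_fixed sub)
  ultimately have dvd: "8 dvd dim (V s)" for s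
  proof -
    obtain k where "dim {x \<in> V s. volume *v x = x} = 4 * k"
      using \<open>4 dvd dim {x \<in> V s. volume *v x = x}\<close> by (rule dvdE)
    then show ?thesis
      using \<open>dim (V s) = 2 * dim {x \<in> V s. volume *v x = x}\<close> by simp
  qed
  have orth: "x \<bullet> y = 0" if "x \<in> V 1" "y \<in> V (-1)" for x y
  proof -
    have "x \<bullet> y = (P 4 *v x) \<bullet> (P 4 *v y)"
      using m by (simp add: P_inner_P)
    also have "\<dots> = - ((volume *v x) \<bullet> (volume *v y))"
      using that by (simp add: V_def)
    finally show ?thesis by (simp add: volume_inner)
  qed
  have decomp: "x \<in> span (V 1 \<union> V (-1))" for x
  proof -
    have "(1/2) *\<^sub>R (x + volume *v (P 4 *v x)) \<in> V 1"
      using m by (simp add: V_def matrix_vector_mult_scaleR matrix_vector_right_distrib comm[symmetric])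
    moreover have "(1/2) *\<^sub>R (x - volume *v (P 4 *v x)) \<in> V (-1)"
      using m by (simp add: V_def matrix_vector_mult_scaleR matrix_vector_mult_diff_distrib
          comm[symmetric] scaleR_diff_right)
    moreover have "x = (1/2) *\<^sub>R (x + volume *v (P 4 *v x)) + (1/2) *\<^sub>R (x - volume *v (P 4 *v x))"
      by (simp flip: scaleR_add_right)
    ultimately show ?thesis
      by (metis UnI1 UnI2 span_add span_base)
  qed
  have not16: "dim (V s) \<noteq> 16" if "s = 1 \<or> s = -1" for s
  proof
    assume "dim (V s) = 16"
    then have "V s = UNIV"
      using sub[of s] card by (metis dim_eq_full span_eq_iff DIM_cart DIM_real mult_1_right)
    then have "P 4 *v x = s *\<^sub>R (volume *v x)" for x
      by (auto simp: V_def)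
    then show False
      using that indef m definite_class_iff by (auto simp: indefinite_class_def)
  qed
  obtain B C where
    B: "B \<subseteq> V 1" "pairwise orthogonal B" "\<And>b. b \<in> B \<Longrightarrow> norm b = 1" "card B = dim (V 1)" "span B = V 1"
    and C: "C \<subseteq> V (-1)" "pairwise orthogonal C" "\<And>b. b \<in> C \<Longrightarrow> norm b = 1" "card C = dim (V (-1))"
      "span C = V (-1)"
    using orthonormal_basis_subspace[OF sub] by metis
  have fin: "finite B" "finite C"
    using B(2) C(2) pairwise_orthogonal_imp_finite by auto
  have disj: "B \<inter> C = {}"
  proof (rule ccontr)
    assume "B \<inter> C \<noteq> {}"
    then obtain b where "b \<in> B" "b \<in> C" by blast
    then show False
      using orth[of b b] B C by (metis inner_eq_zero_iff norm_zero subsetD zero_neq_one)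
  qed
  have BC: "pairwise orthogonal (B \<union> C)"
    using B(1,2) C(1,2) orth
    by (auto simp: pairwise_def orthogonal_def inner_commute) (metis inner_commute orth subsetD)+
  have norm1: "norm b = 1" if "b \<in> B \<union> C" for b
    using that B(3) C(3) by auto
  have span: "span (B \<union> C) = UNIV"
  proof -
    have "V 1 \<union> V (-1) \<subseteq> span (B \<union> C)"
      using B(5) C(5) by (metis Un_least span_mono sup_ge1 sup_ge2)
    then show ?thesis
      using decomp span_minimal[OF _ subspace_span] by blast
  qed
  have "independent (B \<union> C)"
    using BC norm1 by (intro pairwise_orthogonal_independent) force+
  then have "card (B \<union> C) = 16"
    using dim_eq_card_independent[of "B \<union> C"] span card dim_span[of "B \<union> C"] by simp
  then have sum16: "dim (V 1) + dim (V (-1)) = 16"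
    using fin disj B(4) C(4) by (simp add: card_Un_disjoint)
  then have "dim (V 1) = 8" "dim (V (-1)) = 8"
  proof -
    obtain a b where "dim (V 1) = 8 * a" "dim (V (-1)) = 8 * b"
      using dvd by (metis dvdE)
    moreover from this sum16 have "a + b = 2" by simp
    moreover have "a \<noteq> 2" "b \<noteq> 2"
      using not16[of 1] not16[of "-1"] calculation by auto
    ultimately have "a = 1" "b = 1" by auto
    with \<open>dim (V 1) = 8 * a\<close> \<open>dim (V (-1)) = 8 * b\<close>
    show "dim (V 1) = 8" "dim (V (-1)) = 8" by auto
  qed
  moreover have "volume \<bullet> P 4 = (\<Sum>b\<in>B \<union> C. (volume *v b) \<bullet> (P 4 *v b))"
    using BC norm1 span by (rule inner_matrix_orthonormal_basis)
  moreover have "\<dots> = (\<Sum>b\<in>B. (volume *v b) \<bullet> (P 4 *v b)) + (\<Sum>b\<in>C. (volume *v b) \<bullet> (P 4 *v b))"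
    using fin disj by (rule sum.union_disjoint)
  moreover have "(\<Sum>b\<in>B. (volume *v b) \<bullet> (P 4 *v b)) = (\<Sum>b\<in>B. 1)"
    using B(1,3) by (intro sum.cong) (auto simp: V_def volume_inner dot_square_norm)
  moreover have "(\<Sum>b\<in>C. (volume *v b) \<bullet> (P 4 *v b)) = (\<Sum>b\<in>C. - 1)"
    using C(1,3) by (intro sum.cong) (auto simp: V_def volume_inner dot_square_norm)
  ultimately show ?thesis
    using B(4) C(4) by simp
qed

text \<open>
  Divisibility of \<open>l\<close> by four together with \<open>l \<ge> m + 2 \<ge> 5\<close> excludes \<open>l < 8\<close>.
\<close>

lemma sum_of_squares_iff:
  assumes l: "CARD('n) = 2 * l" "m + 2 \<le> l"
  shows "sum_of_squares_of_polynomials (G_F m P) \<longleftrightarrow> l = 8 \<and> \<not> (m = 4 \<and> definite_class P)"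
proof -
  have dim_l: "dim fixed_space = l"
    using dim_fixed_space l by simp
  have "4 dvd l"
    using four_dvd_dim_fixed_space dim_l by simp
  then have l8: "8 \<le> l"
    using l(2) three_le by (elim dvdE) auto
  show ?thesis
  proof (intro iffI conjI notI)
    assume "sum_of_squares_of_polynomials (G_F m P)"
    then show "l = 8"
      using dim_fixed_space_le_8_if_sum_of_squares dim_l l8 by simp
  next
    assume sos: "sum_of_squares_of_polynomials (G_F m P)" and def: "m = 4 \<and> definite_class P"
    then obtain c where "c = 1 \<or> c = - 1" "\<And>x. P 4 *v x = c *\<^sub>R (volume *v x)"
      using definite_class_iff by (metis scaleR_minus1_left scaleR_one)
    then show False
      using not_sum_of_squares_definite sos def dim_l l8 by auto
  next
    assume *: "l = 8 \<and> \<not> (m = 4 \<and> definite_class P)"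
    show "sum_of_squares_of_polynomials (G_F m P)"
    proof (rule sum_of_squares_if_orthogonal)
      show "CARD('n) = 16" using l * by simp
      then show "volume \<bullet> P \<alpha> = 0" if "4 \<le> \<alpha>" "\<alpha> \<le> m" for \<alpha>
        using that * volume_orthogonal_ge5[of \<alpha>] volume_orthogonal_indefinite
        by (cases "m = 4") (auto simp: indefinite_class_def)
    qed
  qed
qed

end

section \<open>The classification\<close>

theorem theorem1p2:
  fixes P :: "nat \<Rightarrow> real^'n^'n" and m l :: nat
  assumes "m \<ge> 1" and "l \<ge> m + 2"
    and "CARD('n) = 2 * l"
    and "symmetric_clifford_system m P"
  shows "sum_of_squares_of_polynomials (G_F m P) \<longleftrightarrow>
      (\<exists>k::nat. k \<ge> 1 \<and> multiplicity_pair m l = (1, k)) \<or>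
      (\<exists>k::nat. k \<ge> 1 \<and> multiplicity_pair m l = (2, 2 * k - 1)) \<or>
      multiplicity_pair m l = (3, 4) \<or>
      (multiplicity_pair m l = (4, 3) \<and> indefinite_class P) \<or>
      multiplicity_pair m l = (5, 2) \<or>
      multiplicity_pair m l = (6, 1)"
proof -
  interpret clifford_system m P
    using assms(4) by unfold_locales
  consider "m = 1" | "m = 2" | "3 \<le> m"
    using assms(1) by linarith
  then show ?thesis
  proof cases
    case 1
    then show ?thesis
      using sum_of_squares_m_eq_1 assms(2) by (auto simp: multiplicity_pair_def)
  next
    case 2
    then have "even l"
      using four_dvd_CARD assms(3) by (metis dvd_mult_cancel1 le_refl mult_2 nat_mult_dvd_cancel1
          numeral_Bit0 numeral_times_numeral zero_less_numeral)
    then obtain k where "l = 2 * k" by blast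
    then have "1 \<le> k - 1 \<and> multiplicity_pair m l = (2, 2 * (k - 1) - 1)"
      using 2 assms(2) by (auto simp: multiplicity_pair_def)
    then show ?thesis
      using sum_of_squares_m_eq_2[OF 2] by blast
  next
    case 3
    then interpret clifford_system_ge3 m P
      by unfold_locales
    have "m \<le> 6 \<longrightarrow> m = 3 \<or> m = 4 \<or> m = 5 \<or> m = 6"
      using 3 by linarith
    then show ?thesis
      unfolding sum_of_squares_iff[OF assms(3,2)] using assms(2) 3
      by (auto simp: multiplicity_pair_def indefinite_class_def)
  qed
qed

end
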